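(* Assume that $\varphi$ is differentiable. Let $\mathcal{G}$ be a collection (finite or infinite, countable or not) of measurable real valued functions on $\mathcal{X}$ containing $\mathbf{1}_{\mathcal{X}}$, and let $$S:=\left\{Q\in\mathcal{M}_{\mathcal{G}}(P):\ \int_{\mathcal{X}}dQ=1,\ \int_{\mathcal{X}}g\,dQ=0\text{ for all }g\in\mathcal{G}\setminus\{\mathbf{1}_{\mathcal{X}}\}\right\}.$$ (1) Let $Q^*$ be a (signed) finite measure in $S\cap\mathrm{dom}\,\phi$, with $q^*:=\frac{dQ^*}{dP}$. A sufficient condition for $Q^*$ to be a $\phi$-projection of $P$ on $S$ is that there exist numbers $c_1,\ldots,c_d\in\mathbb{R}$ and functions $g_1,\ldots,g_d\in\mathcal{G}$ such that $\varphi'(q^*(x))=c_1g_1(x)+\cdots+c_dg_d(x)$ ($P$-a.e.). (2) Assume that there exists $0<\delta<1$ such that for all $c\in[1-\delta,1+\delta]$ one can find numbers $c_1,c_2,c_3$ with $\varphi(cx)\le c_1\varphi(x)+c_2|x|+c_3$ for all real $x$. Then any $\phi$-projection $Q^*$ of $P$ on $S$, if it exists, is such that $\varphi'(q^* )$, where $q^*:=\frac{dQ^*}{dP}$, belongs to the closure of $\langle\mathcal{G}\rangle$ in $L_1(\mathcal{X},|Q^*|)$.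
   Context: $(\mathcal{X},\mathcal{B})$ is a measurable space and $P$ a given probability measure on it. $\mathcal{M}$ is the real vector space of all signed finite measures on $(\mathcal{X},\mathcal{B})$, and $\mathcal{M}(P)$ the subspace of those absolutely continuous w.r.t. $P$. $|Q|$ denotes the total variation of $Q$. $\mathcal{M}_{\mathcal{G}}(P):=\{Q\in\mathcal{M}(P):\int|g|\,d|Q|<\infty\text{ for all }g\in\mathcal{G}\}$, and $\langle\mathcal{G}\rangle$ is the linear span of $\mathcal{G}$. The function $\varphi:\mathbb{R}\to[0,+\infty]$ is proper, convex and closed, with $\varphi(1)=0$, and its domain $\{x:\varphi(x)<\infty\}$ is an interval with endpoints $a_\varphi<1<b_\varphi$ (finite or infinite). Closed means that $\varphi(x)\to\varphi(a_\varphi)$ as $x\downarrow a_\varphi$ if $a_\varphi$ is finite, and $\varphi(x)\to\varphi(b_\varphi)$ as $x\uparrow b_\varphi$ if $b_\varphi$ is finite (equivalently, $\varphi$ is lower semi-continuous). "Differentiable" means differentiable on $]a_\varphi,b_\varphi[$; then $\varphi'(a_\varphi)$ and $\varphi'(b_\varphi)$ denote the (finite or infinite) limits of $\varphi'(x)$ as $x\downarrow a_\varphi$ and $x\uparrow b_\varphi$. For $Q\in\mathcal{M}(P)$ put $\phi(Q,P):=\int_{\mathcal{X}}\varphi\left(\frac{dQ}{dP}\right)dP$, and $\phi(Q,P):=+\infty$ if $Q\in\mathcal{M}\setminus\mathcal{M}(P)$. $\mathrm{dom}\,\phi:=\{Q\in\mathcal{M}:\phi(Q,P)<\infty\}$.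 For $\Omega\subseteq\mathcal{M}$ with $\inf_{Q\in\Omega}\phi(Q,P)<\infty$, a $\phi$-projection of $P$ on $\Omega$ is a measure $Q^*\in\Omega$ such that $\phi(Q^*,P)\le\phi(Q,P)$ for all $Q\in\Omega$. *)

theory Defs
  imports "HOL-Probability.Probability" "HOL-Library.Function_Algebras"
begin

text \<open>
  A signed finite measure on the measurable space underlying a measure \<open>M\<close> is represented by its
  set function. Requiring the value 0 off \<open>sets M\<close> makes the representation unique.
\<close>

definition signed_measures :: "'a measure \<Rightarrow> ('a set \<Rightarrow> real) set" where
  "signed_measures M = {Q.
     Q {} = 0 \<and>
     (\<forall>A. range A \<subseteq> sets M \<longrightarrow> disjoint_family A \<longrightarrow> (\<lambda>i::nat. Q (A i)) sums Q (\<Union>i. A i)) \<and>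
     (\<forall>A. A \<notin> sets M \<longrightarrow> Q A = 0)}"

text \<open>
  Upper and lower variation (the Jordan components) and total variation of a signed measure.
\<close>

definition pos_part :: "'a measure \<Rightarrow> ('a set \<Rightarrow> real) \<Rightarrow> 'a measure" where
  "pos_part M Q = measure_of (space M) (sets M) (\<lambda>A. SUP B\<in>{B \<in> sets M. B \<subseteq> A}. ennreal (Q B))"

definition neg_part :: "'a measure \<Rightarrow> ('a set \<Rightarrow> real) \<Rightarrow> 'a measure" where
  "neg_part M Q = pos_part M (\<lambda>A. - Q A)"

definition total_var :: "'a measure \<Rightarrow> ('a set \<Rightarrow> real) \<Rightarrow> 'a measure" where
  "total_var M Q = measure_of (space M) (sets M)
     (\<lambda>A. emeasure (pos_part M Q) A + emeasure (neg_part M Q) A)"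

definition signed_integral :: "'a measure \<Rightarrow> ('a set \<Rightarrow> real) \<Rightarrow> ('a \<Rightarrow> real) \<Rightarrow> real" where
  "signed_integral M Q g = (\<integral>x. g x \<partial>pos_part M Q) - (\<integral>x. g x \<partial>neg_part M Q)"

definition ac_signed_measures :: "'a measure \<Rightarrow> ('a set \<Rightarrow> real) set" where
  "ac_signed_measures P = {Q \<in> signed_measures P. \<forall>A\<in>null_sets P. Q A = 0}"

text \<open>\<open>dQ/dP\<close>; the library's \<^const>\<open>RN_deriv\<close> only covers nonnegative measures.\<close>

definition density_of :: "'a measure \<Rightarrow> ('a set \<Rightarrow> real) \<Rightarrow> 'a \<Rightarrow> real" where
  "density_of P Q = (SOME q. integrable P q \<and>
     (\<forall>A\<in>sets P. Q A = (LINT x:A|P. q x)))"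

definition phi_dom :: "(real \<Rightarrow> ennreal) \<Rightarrow> real set" where
  "phi_dom \<phi> = {x. \<phi> x < \<infinity>}"

definition phi_lo :: "(real \<Rightarrow> ennreal) \<Rightarrow> ereal" where
  "phi_lo \<phi> = (INF x\<in>phi_dom \<phi>. ereal x)"

definition phi_hi :: "(real \<Rightarrow> ennreal) \<Rightarrow> ereal" where
  "phi_hi \<phi> = (SUP x\<in>phi_dom \<phi>. ereal x)"

definition ext_convex :: "(real \<Rightarrow> ennreal) \<Rightarrow> bool" where
  "ext_convex \<phi> \<longleftrightarrow> (\<forall>x y. \<forall>t\<in>{0..1}.
     \<phi> ((1 - t) * x + t * y) \<le> ennreal (1 - t) * \<phi> x + ennreal t * \<phi> y)"

definition ext_closed :: "(real \<Rightarrow> ennreal) \<Rightarrow> bool" where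
  "ext_closed \<phi> \<longleftrightarrow>
     (\<forall>a. phi_lo \<phi> = ereal a \<longrightarrow> (\<phi> \<longlongrightarrow> \<phi> a) (at_right a)) \<and>
     (\<forall>b. phi_hi \<phi> = ereal b \<longrightarrow> (\<phi> \<longlongrightarrow> \<phi> b) (at_left b))"

text \<open>
  Properness follows from \<open>\<phi> 1 = 0\<close> and \<open>\<phi> \<ge> 0\<close>; that the domain is an interval follows from convexity.
\<close>

definition divergence_fun :: "(real \<Rightarrow> ennreal) \<Rightarrow> bool" where
  "divergence_fun \<phi> \<longleftrightarrow>
     ext_convex \<phi> \<and> ext_closed \<phi> \<and> \<phi> 1 = 0 \<and> phi_lo \<phi> < 1 \<and> 1 < phi_hi \<phi>"

definition phi_differentiable :: "(real \<Rightarrow> ennreal) \<Rightarrow> bool" where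
  "phi_differentiable \<phi> \<longleftrightarrow>
     (\<forall>x. phi_lo \<phi> < ereal x \<and> ereal x < phi_hi \<phi> \<longrightarrow> (\<lambda>y. enn2real (\<phi> y)) differentiable (at x))"

text \<open>
  The derivative, extended to finite endpoints of the domain by its one-sided (possibly infinite)
  limits there. Its values outside the closure of the domain carry no meaning.
\<close>

definition dphi :: "(real \<Rightarrow> ennreal) \<Rightarrow> real \<Rightarrow> ereal" where
  "dphi \<phi> x =
     (let d = (\<lambda>y. ereal (deriv (\<lambda>z. enn2real (\<phi> z)) y)) in
      if ereal x = phi_lo \<phi> then Lim (at_right x) d
      else if ereal x = phi_hi \<phi> then Lim (at_left x) d
      else d x)"

definition phi_div :: "(real \<Rightarrow> ennreal) \<Rightarrow> ('a set \<Rightarrow> real) \<Rightarrow> 'a measure \<Rightarrow> ennreal" where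
  "phi_div \<phi> Q P =
     (if Q \<in> ac_signed_measures P then \<integral>\<^sup>+x. \<phi> (density_of P Q x) \<partial>P else \<infinity>)"

definition div_dom :: "(real \<Rightarrow> ennreal) \<Rightarrow> 'a measure \<Rightarrow> ('a set \<Rightarrow> real) set" where
  "div_dom \<phi> P = {Q \<in> signed_measures P. phi_div \<phi> Q P < \<infinity>}"

definition is_projection ::
  "(real \<Rightarrow> ennreal) \<Rightarrow> 'a measure \<Rightarrow> ('a set \<Rightarrow> real) set \<Rightarrow> ('a set \<Rightarrow> real) \<Rightarrow> bool" where
  "is_projection \<phi> P \<Omega> Q' \<longleftrightarrow>
     (INF Q\<in>\<Omega>. phi_div \<phi> Q P) < \<infinity> \<and> Q' \<in> \<Omega> \<and> (\<forall>Q\<in>\<Omega>. phi_div \<phi> Q' P \<le> phi_div \<phi> Q P)"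

definition ac_signed_measures_wrt :: "('a \<Rightarrow> real) set \<Rightarrow> 'a measure \<Rightarrow> ('a set \<Rightarrow> real) set" where
  "ac_signed_measures_wrt G P =
     {Q \<in> ac_signed_measures P. \<forall>g\<in>G. (\<integral>\<^sup>+x. ennreal \<bar>g x\<bar> \<partial>total_var P Q) < \<infinity>}"

text \<open>
  A function on \<open>space P\<close> is identified with its extension by 0 to the whole type, so the constant
  function 1 is the indicator of \<open>space P\<close>.
\<close>

definition constraint_set :: "('a \<Rightarrow> real) set \<Rightarrow> 'a measure \<Rightarrow> ('a set \<Rightarrow> real) set" where
  "constraint_set G P =
     {Q \<in> ac_signed_measures_wrt G P.
        signed_integral P Q (indicat_real (space P)) = 1 \<and>
        (\<forall>g\<in>G - {indicat_real (space P)}. signed_integral P Q g = 0)}"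

definition fun_span :: "('a \<Rightarrow> real) set \<Rightarrow> ('a \<Rightarrow> real) set" where
  "fun_span = module.span (\<lambda>(c::real) f x. c * f x)"

definition L1_closure :: "'a measure \<Rightarrow> ('a \<Rightarrow> real) set \<Rightarrow> ('a \<Rightarrow> real) set" where
  "L1_closure M F = {f. integrable M f \<and>
     (\<forall>\<epsilon>>0. \<exists>h\<in>F. integrable M h \<and> (\<integral>x. \<bar>f x - h x\<bar> \<partial>M) < \<epsilon>)}"

end

theory Submission
  imports Defs
begin

text \<open>
  Write \<open>F\<close> for the finite part of \<open>\<phi>\<close> and \<open>q = dQ/dP\<close>. By the Radon-Nikodym theorem for signed
  measures, \<open>|Q|\<close> has \<open>P\<close>-density \<open>|q|\<close> and the constraints become \<open>\<integral> g q dP = 0\<close> for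
  \<open>g\<close> other than the constant 1, and \<open>\<integral> q dP = 1\<close>. All measures in the constraint set therefore
  integrate any linear combination of members of \<open>G\<close> to the same value.

  Sufficiency (\<open>projection_if_dphi_in_span\<close>). Convexity gives the tangent inequality
  \<open>F r \<ge> F q + \<phi>'(q) (r - q)\<close>, which persists at a finite endpoint of the domain as long as the
  one-sided limit of \<open>\<phi>'\<close> is finite there (\<open>dphi_subgradient\<close>). If \<open>\<phi>'(q)\<close> is a linear combination
  of constraints, then the linear term integrates to zero for every competitor \<open>r\<close>.

  Necessity (\<open>dphi_in_L1_closure\<close>). The growth condition makes the domain of \<open>\<phi>\<close> invariant under
  the dilations \<open>x \<mapsto> (1 \<plusminus> \<delta>) x\<close>. So \<open>q\<close> lies in the interior of the domain wherever it is nonzero,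
  and \<open>F((1 \<plusminus> \<delta>) q)\<close> is integrable, which forces \<open>\<phi>'(q)\<close> to be \<open>|Q|\<close>-integrable. Let \<open>h\<close> be bounded
  and annihilate \<open>G\<close> in \<open>L1(|Q|)\<close>. Then the measures with density \<open>q (1 + t h sgn q)\<close> satisfy
  the constraints for small \<open>t\<close>, so the derivative of their divergence at \<open>t = 0\<close>, which is
  \<open>\<integral> \<phi>'(q) h d|Q|\<close>, vanishes (\<open>first_variation_nonneg\<close>, applied to \<open>h\<close> and \<open>-h\<close>).

  It remains to see that a function killed by every bounded annihilator of a subspace \<open>V\<close> of \<open>L1\<close>
  lies in the closure of \<open>V\<close>. This is usually derived from the Hahn-Banach theorem and the duality of
  \<open>L1\<close> and \<open>L\<infinity>\<close>; here it is obtained by minimizing a smooth substitute for the \<open>L1\<close> distance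
  (\<open>L1_approx_if_annihilated\<close>).
\<close>

section \<open>Approximation in L1 from annihilators\<close>

text \<open>
  The metric projection onto \<open>[-1, 1]\<close>, which is also the derivative of \<open>huber\<close>.
\<close>

definition clip :: "real \<Rightarrow> real" where
  "clip x = max (- 1) (min 1 x)"

text \<open>
  The Huber function \<open>x\<^sup>2 / 2\<close> for \<open>|x| \<le> 1\<close> and \<open>|x| - 1/2\<close> otherwise, i.e. the maximum of
  \<open>p x - p\<^sup>2 / 2\<close> over \<open>|p| \<le> 1\<close>, attained at \<open>p = clip x\<close>. It grows like \<open>|x|\<close>, so it can be
  integrated over \<open>L1\<close> functions, while its derivative is bounded and Lipschitz. This form avoids
  case distinctions in the inequalities below.
\<close>

definition huber :: "real \<Rightarrow> real" where
  "huber x = clip x * x - (clip x)\<^sup>2 / 2"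

lemma abs_clip_le: "\<bar>clip x\<bar> \<le> 1"
  by (auto simp: clip_def)

lemma clip_measurable [measurable]: "clip \<in> borel_measurable borel"
  unfolding clip_def by measurable

lemma huber_measurable [measurable]: "huber \<in> borel_measurable borel"
  unfolding huber_def by measurable

lemma clip_diff_le: "\<bar>clip b - clip a\<bar> \<le> min 2 \<bar>b - a\<bar>"
  by (auto simp: clip_def min_def max_def)

text \<open>
  The quadratic gain comes from the variational characterization of the projection:
  \<open>(clip b - p) (b - clip b) \<ge> 0\<close> for all \<open>p\<close> in \<open>[-1, 1]\<close>.
\<close>

lemma huber_above_tangent:
  "huber a + clip a * (b - a) + (clip b - clip a)\<^sup>2 / 2 \<le> huber b"
proof -
  have "(clip b - clip a) * (b - clip b) \<ge> 0"
    using abs_clip_le[of a] by (cases "\<bar>b\<bar> \<le> 1") (auto simp: clip_def zero_le_mult_iff)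
  then show ?thesis
    by (simp add: huber_def power2_eq_square field_simps)
qed

text \<open>
  The remainder does not depend on \<open>a\<close>. It is of first order for large steps, hence integrable for
  every \<open>L1\<close> increment, and of second order for small ones.
\<close>

lemma huber_below_tangent:
  "huber b \<le> huber a + clip a * (b - a) + \<bar>b - a\<bar> * min 2 \<bar>b - a\<bar>"
proof -
  have "huber b + clip b * (a - b) + (clip a - clip b)\<^sup>2 / 2 \<le> huber a"
    by (rule huber_above_tangent)
  then have "huber b \<le> huber a + clip b * (b - a)"
    using zero_le_power2[of "clip a - clip b"] by (simp only: right_diff_distrib)
  also have "clip b * (b - a) = clip a * (b - a) + (clip b - clip a) * (b - a)"
    by (simp add: algebra_simps)
  also have "(clip b - clip a) * (b - a) \<le> \<bar>b - a\<bar> * min 2 \<bar>b - a\<bar>"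
    by (rule order_trans[OF abs_ge_self])
      (metis abs_mult mult.commute mult_left_mono clip_diff_le abs_ge_zero)
  finally show ?thesis by simp
qed

lemma huber_step:
  assumes "t > 0"
  shows "huber (a + t * w) \<le> huber a + t * (clip a * w) + t * (\<bar>w\<bar> * min 2 (t * \<bar>w\<bar>))"
  using huber_below_tangent[of "a + t * w" a] assms by (simp add: abs_mult mult_ac)

lemma huber_nonneg: "0 \<le> huber x"
proof -
  have "0 \<le> (clip x - clip 0)\<^sup>2 / 2" by simp
  also have "\<dots> \<le> huber x" using huber_above_tangent[of 0 x] by (simp add: huber_def clip_def)
  finally show ?thesis .
qed

lemma huber_le_abs: "huber x \<le> \<bar>x\<bar>"
proof -
  have "clip x * x \<le> \<bar>x\<bar>"
    by (rule order_trans[OF abs_ge_self]) (simp add: abs_mult mult_left_le_one_le abs_clip_le)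
  moreover have "0 \<le> (clip x)\<^sup>2 / 2" by simp
  ultimately show ?thesis unfolding huber_def by linarith
qed

lemma abs_le_huber:
  assumes "0 < \<epsilon>" "\<epsilon> \<le> 1"
  shows "\<bar>x\<bar> \<le> \<epsilon> + 2 / \<epsilon> * huber x"
proof (cases "\<bar>x\<bar> \<le> \<epsilon>")
  case True
  then show ?thesis using huber_nonneg[of x] assms by (simp add: add_increasing2)
next
  case False
  have "\<epsilon> * \<bar>x\<bar> \<le> 2 * huber x"
  proof (cases "\<bar>x\<bar> \<le> 1")
    case True
    then have "2 * huber x = \<bar>x\<bar> * \<bar>x\<bar>"
      by (simp add: huber_def clip_def power2_eq_square)
    moreover have "\<epsilon> * \<bar>x\<bar> \<le> \<bar>x\<bar> * \<bar>x\<bar>" using False by (intro mult_right_mono) auto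
    ultimately show ?thesis by simp
  next
    case F: False
    then have "2 * huber x = 2 * \<bar>x\<bar> - 1"
      by (cases "x > 0") (auto simp: huber_def clip_def)
    moreover have "\<epsilon> * \<bar>x\<bar> \<le> \<bar>x\<bar>"
      using assms by (simp add: mult_left_le_one_le)
    ultimately show ?thesis using F by linarith
  qed
  then have "\<bar>x\<bar> \<le> 2 / \<epsilon> * huber x" using assms by (simp add: field_simps)
  then show ?thesis using assms by linarith
qed

text \<open>
  If two functions almost minimize a convex functional then so does their midpoint. This bound
  therefore controls the distance of the derivatives at two almost minimizers.
\<close>

lemma huber_midpoint:
  "(clip a - clip b)\<^sup>2 \<le> 4 * (huber a + huber b - 2 * huber ((a + b) / 2))"
proof -
  define c where "c = (a + b) / 2"
  have e: "a - c = - (b - c)" by (simp add: c_def field_simps)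
  have "(clip a - clip c)\<^sup>2 / 2 + (clip b - clip c)\<^sup>2 / 2 \<le> huber a + huber b - 2 * huber c"
    using huber_above_tangent[of c a] huber_above_tangent[of c b] unfolding e by (simp add: algebra_simps)
  moreover have "(clip a - clip b)\<^sup>2 \<le> 2 * ((clip a - clip c)\<^sup>2 + (clip b - clip c)\<^sup>2)"
    using zero_le_power2[of "(clip a - clip c) + (clip b - clip c)"]
    by (simp add: power2_eq_square algebra_simps)
  ultimately show ?thesis unfolding c_def[symmetric] by argo
qed

lemma integrable_huber:
  assumes "integrable M u" shows "integrable M (\<lambda>x. huber (u x))"
  by (rule Bochner_Integration.integrable_bound[OF integrable_norm[OF assms]])
    (use assms huber_nonneg huber_le_abs in auto)

lemma integrable_bounded_mult:
  fixes h u :: "'a \<Rightarrow> real"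
  assumes "integrable M u" and [measurable]: "h \<in> borel_measurable M" and "\<And>x. \<bar>h x\<bar> \<le> C"
  shows "integrable M (\<lambda>x. h x * u x)"
proof (rule Bochner_Integration.integrable_bound[where f = "\<lambda>x. C * \<bar>u x\<bar>"])
  show "AE x in M. norm (h x * u x) \<le> norm (C * \<bar>u x\<bar>)"
  proof (rule AE_I2)
    fix x show "norm (h x * u x) \<le> norm (C * \<bar>u x\<bar>)"
      using assms(3)[of x] by (auto simp: abs_mult intro!: mult_right_mono)
  qed
qed (use assms in auto)

text \<open>
  The residuals \<open>g - v n\<close> of a minimizing sequence need not converge, but by \<open>huber_midpoint\<close>
  their images under \<open>clip\<close> form a Cauchy sequence in \<open>L2\<close>. A subsequence converges almost
  everywhere to some \<open>h\<close>, and the vanishing first variation of \<open>J\<close> says that \<open>h\<close> annihilates \<open>V\<close>.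
\<close>

lemma (in finite_measure) minimizing_residuals_converge:
  fixes g :: "'a \<Rightarrow> real"
  assumes V: "(\<lambda>x. 0) \<in> V" "\<And>a u v. u \<in> V \<Longrightarrow> v \<in> V \<Longrightarrow> (\<lambda>x. a * u x + v x) \<in> V"
    and int: "\<And>v. v \<in> V \<Longrightarrow> integrable M v" and g: "integrable M g"
  defines "J \<equiv> \<lambda>v. \<integral>x. huber (g x - v x) \<partial>M"
  obtains v h where "\<And>n::nat. v n \<in> V" "(\<lambda>n. J (v n)) \<longlonglongrightarrow> (INF v\<in>V. J v)"
    "AE x in M. (\<lambda>n. clip (g x - v n x)) \<longlonglongrightarrow> h x"
    "h \<in> borel_measurable M" "\<And>x. \<bar>h x\<bar> \<le> 1" "\<And>w. w \<in> V \<Longrightarrow> (\<integral>x. h x * w x \<partial>M) = 0"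
proof -
  define m where "m = (INF v\<in>V. J v)"
  note [measurable] = borel_measurable_integrable[OF g] borel_measurable_integrable[OF int]
  have ih: "integrable M (\<lambda>x. huber (g x - v x))" if "v \<in> V" for v
    by (intro integrable_huber Bochner_Integration.integrable_diff g int that)
  have bdd: "bdd_below (J ` V)"
    unfolding J_def by (intro bdd_belowI[of _ 0]) (auto intro!: Bochner_Integration.integral_nonneg huber_nonneg)
  have le: "m \<le> J v" if "v \<in> V" for v
    unfolding m_def using bdd that by (rule cINF_lower)
  have ne: "V \<noteq> {}" using V(1) by auto
  have "\<exists>v\<in>V. J v < m + 1 / real (Suc n)" for n
    using cINF_less_iff[OF ne bdd, of "m + 1 / real (Suc n)"] by (simp add: m_def)
  then obtain v0 where v0: "\<And>n. v0 n \<in> V" "\<And>n. J (v0 n) < m + 1 / real (Suc n)"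
    by metis
  define h0 where "h0 n x = clip (g x - v0 n x)" for n x
  have h0_meas [measurable]: "h0 n \<in> borel_measurable M" for n
    unfolding h0_def using v0 by measurable
  have h0_bd: "\<bar>h0 n x\<bar> \<le> 1" for n x unfolding h0_def by (rule abs_clip_le)
  have h0_int: "integrable M (h0 n)" for n
    by (rule integrable_const_bound[of _ 1]) (use h0_bd in auto)
  have sq_int: "integrable M (\<lambda>x. (h0 i x - h0 j x)\<^sup>2)" for i j
  proof (rule integrable_const_bound[of _ 4])
    show "AE x in M. norm ((h0 i x - h0 j x)\<^sup>2) \<le> 4"
    proof (rule AE_I2)
      fix x
      have "\<bar>h0 i x - h0 j x\<bar> \<le> 2" using h0_bd[of i x] h0_bd[of j x] by linarith
      then show "norm ((h0 i x - h0 j x)\<^sup>2) \<le> 4"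
        using power_mono[of "\<bar>h0 i x - h0 j x\<bar>" 2 2] by simp
    qed
  qed auto
  have sq: "(\<integral>x. (h0 i x - h0 j x)\<^sup>2 \<partial>M) \<le> 4 * (1 / real (Suc i) + 1 / real (Suc j))" for i j
  proof -
    define w where "w x = (1/2) * v0 i x + ((1/2) * v0 j x + 0)" for x
    have wV: "w \<in> V" unfolding w_def by (intro V v0)
    have "(\<integral>x. (h0 i x - h0 j x)\<^sup>2 \<partial>M)
        \<le> (\<integral>x. 4 * (huber (g x - v0 i x) + huber (g x - v0 j x) - 2 * huber (g x - w x)) \<partial>M)"
    proof (rule integral_mono)
      fix x
      have "(g x - v0 i x + (g x - v0 j x)) / 2 = g x - w x" by (simp add: w_def field_simps)
      then show "(h0 i x - h0 j x)\<^sup>2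
          \<le> 4 * (huber (g x - v0 i x) + huber (g x - v0 j x) - 2 * huber (g x - w x))"
        using huber_midpoint[of "g x - v0 i x" "g x - v0 j x"] unfolding h0_def by metis
    qed (use sq_int ih v0 wV in auto)
    also have "\<dots> = 4 * (J (v0 i) + J (v0 j) - 2 * J w)"
      unfolding J_def using ih[OF v0(1)[of i]] ih[OF v0(1)[of j]] ih[OF wV] by simp
    also have "\<dots> \<le> 4 * (1 / real (Suc i) + 1 / real (Suc j))"
      using v0(2)[of i] v0(2)[of j] le[OF wV] by argo
    finally show ?thesis .
  qed
  have cau: "\<exists>N. \<forall>i\<ge>N. \<forall>j\<ge>N. (\<integral>x. norm (h0 i x - h0 j x) \<partial>M) < e" if e: "0 < e" for e :: real
  proof -
    define \<mu> where "\<mu> = measure M (space M) + 1"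
    have \<mu>: "\<mu> > 0" by (simp add: \<mu>_def add_nonneg_pos)
    define \<eta> where "\<eta> = e / (2 * \<mu>)"
    have \<eta>: "\<eta> > 0" using e \<mu> by (simp add: \<eta>_def)
    obtain N :: nat where N: "1 / real (Suc N) < e * \<eta> / 16"
      using nat_approx_posE[of "e * \<eta> / 16"] e \<eta> by (metis divide_pos_pos mult_pos_pos zero_less_numeral)
    show ?thesis
    proof (intro exI allI impI)
      fix i j assume ij: "N \<le> i" "N \<le> j"
      have *: "1 / real (Suc i) \<le> 1 / real (Suc N)" "1 / real (Suc j) \<le> 1 / real (Suc N)"
        using ij by (auto intro!: divide_left_mono)
      \<comment> \<open>Passing from \<open>L2\<close> to \<open>L1\<close> by \<open>y \<le> \<eta> + y\<^sup>2 / \<eta>\<close>, which is available on a finite measure space.\<close>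
      have "(\<integral>x. norm (h0 i x - h0 j x) \<partial>M) \<le> (\<integral>x. \<eta> + (h0 i x - h0 j x)\<^sup>2 / \<eta> \<partial>M)"
      proof (rule integral_mono)
        fix x
        define y where "y = \<bar>h0 i x - h0 j x\<bar>"
        have "0 \<le> (2 * \<eta> - y)\<^sup>2 + 3 * y\<^sup>2" by simp
        then have "\<eta> * y \<le> \<eta> * \<eta> + y * y"
          by (simp add: power2_eq_square algebra_simps)
        then have "y \<le> \<eta> + y\<^sup>2 / \<eta>" using \<eta> by (simp add: field_simps power2_eq_square)
        then show "norm (h0 i x - h0 j x) \<le> \<eta> + (h0 i x - h0 j x)\<^sup>2 / \<eta>" by (simp add: y_def)
      qed (use h0_int sq_int in auto)
      also have "\<dots> = \<eta> * measure M (space M) + (\<integral>x. (h0 i x - h0 j x)\<^sup>2 \<partial>M) / \<eta>"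
        using sq_int[of i j] by simp
      also have "\<dots> \<le> \<eta> * \<mu> + (4 * (1 / real (Suc i) + 1 / real (Suc j))) / \<eta>"
        using sq[of i j] \<eta> by (intro add_mono divide_right_mono mult_left_mono) (auto simp: \<mu>_def)
      also have "\<dots> \<le> \<eta> * \<mu> + (8 * (1 / real (Suc N))) / \<eta>"
        using * \<eta> by (intro add_mono divide_right_mono) auto
      also have "\<dots> < \<eta> * \<mu> + (8 * (e * \<eta> / 16)) / \<eta>"
        using N \<eta> by (intro add_strict_left_mono divide_strict_right_mono mult_strict_left_mono) auto
      also have "\<dots> = e" using \<eta> \<mu> by (simp add: \<eta>_def)
      finally show "(\<integral>x. norm (h0 i x - h0 j x) \<partial>M) < e" .
    qed
  qed
  obtain r where r: "strict_mono r" "AE x in M. Cauchy (\<lambda>i. h0 (r i) x)"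
    using cauchy_L1_AE_cauchy_subseq[OF h0_int cau] by blast
  \<comment> \<open>Clipping the limit changes nothing where it exists and keeps \<open>h\<close> bounded everywhere.\<close>
  define h where "h x = clip (lim (\<lambda>i. h0 (r i) x))" for x
  define v where "v n = v0 (r n)" for n
  have vV: "v n \<in> V" for n by (simp add: v_def v0)
  have lim_inv: "(\<lambda>n. 1 / real (Suc (r n))) \<longlonglongrightarrow> 0"
    using LIMSEQ_subseq_LIMSEQ[OF LIMSEQ_inverse_real_of_nat r(1)] by (simp add: o_def inverse_eq_divide)
  have Jlim: "(\<lambda>n. J (v n)) \<longlonglongrightarrow> m"
  proof (rule tendsto_sandwich[of "\<lambda>_. m" _ _ "\<lambda>n. m + 1 / real (Suc (r n))"])
    show "\<forall>\<^sub>F n in sequentially. m \<le> J (v n)" using le vV by simp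
    show "\<forall>\<^sub>F n in sequentially. J (v n) \<le> m + 1 / real (Suc (r n))"
      using v0(2) by (simp add: v_def less_imp_le)
    show "(\<lambda>n. m + 1 / real (Suc (r n))) \<longlonglongrightarrow> m"
      using tendsto_add[OF tendsto_const lim_inv, of m] by simp
  qed simp
  have hlim: "AE x in M. (\<lambda>n. clip (g x - v n x)) \<longlonglongrightarrow> h x"
    using r(2)
  proof eventually_elim
    fix x assume "Cauchy (\<lambda>i. h0 (r i) x)"
    then have l: "(\<lambda>i. h0 (r i) x) \<longlonglongrightarrow> lim (\<lambda>i. h0 (r i) x)"
      by (simp add: Cauchy_convergent_iff convergent_LIMSEQ_iff)
    have "(\<lambda>i. \<bar>h0 (r i) x\<bar>) \<longlonglongrightarrow> \<bar>lim (\<lambda>i. h0 (r i) x)\<bar>"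
      using tendsto_rabs[OF l] .
    then have "\<bar>lim (\<lambda>i. h0 (r i) x)\<bar> \<le> 1"
      by (rule LIMSEQ_le_const2) (use h0_bd in auto)
    then have "h x = lim (\<lambda>i. h0 (r i) x)" by (auto simp: h_def clip_def)
    then show "(\<lambda>n. clip (g x - v n x)) \<longlonglongrightarrow> h x"
      using l by (simp add: h0_def v_def)
  qed
  have h_meas [measurable]: "h \<in> borel_measurable M"
    unfolding h_def by measurable
  have h_bd: "\<bar>h x\<bar> \<le> 1" for x unfolding h_def by (rule abs_clip_le)
  have ann: "(\<integral>x. h x * w x \<partial>M) \<le> 0" if w: "w \<in> V" for w
  proof -
    note [measurable] = borel_measurable_integrable[OF int[OF w]]
      borel_measurable_integrable[OF int[OF vV]]
    \<comment> \<open>\<open>\<rho> t\<close> is the remainder of \<open>huber_below_tangent\<close> in direction \<open>w\<close> divided by the step size \<open>t\<close>.\<close>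
    define \<rho> where "\<rho> t = (\<integral>x. \<bar>w x\<bar> * min 2 (t * \<bar>w x\<bar>) \<partial>M)" for t
    have L1: "(\<lambda>n. \<integral>x. clip (g x - v n x) * w x \<partial>M) \<longlonglongrightarrow> (\<integral>x. h x * w x \<partial>M)"
    proof (rule integral_dominated_convergence[where w = "\<lambda>x. \<bar>w x\<bar>"])
      show "AE x in M. (\<lambda>n. clip (g x - v n x) * w x) \<longlonglongrightarrow> h x * w x"
        using hlim by eventually_elim (intro tendsto_intros)
      show "AE x in M. norm (clip (g x - v n x) * w x) \<le> \<bar>w x\<bar>" for n
        using abs_clip_le by (intro AE_I2) (auto simp: abs_mult intro!: mult_left_le_one_le)
    qed (use int[OF w] in auto)
    have step: "(\<integral>x. h x * w x \<partial>M) \<le> \<rho> t" if t: "t > 0" for t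
    proof -
      have int_\<rho>: "integrable M (\<lambda>x. \<bar>w x\<bar> * min 2 (t * \<bar>w x\<bar>))"
      proof -
        have "integrable M (\<lambda>x. min 2 (t * \<bar>w x\<bar>) * \<bar>w x\<bar>)"
          by (rule integrable_bounded_mult[where C = 2]) (use int[OF w] t in auto)
        then show ?thesis by (simp add: mult.commute)
      qed
      have int_c: "integrable M (\<lambda>x. clip (g x - v n x) * w x)" for n
        by (rule integrable_bounded_mult[where C = 1]) (use int[OF w] abs_clip_le in auto)
      have "t * (\<integral>x. clip (g x - v n x) * w x \<partial>M) \<le> J (v n) - m + t * \<rho> t" for n
      proof -
        define u where "u x = t * w x + v n x" for x
        have uV: "u \<in> V" unfolding u_def by (intro V w vV)
        have "m \<le> J u" by (rule le[OF uV])
        also have "J u \<le> (\<integral>x. huber (g x - v n x) - t * (clip (g x - v n x) * w x)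
             + t * (\<bar>w x\<bar> * min 2 (t * \<bar>w x\<bar>)) \<partial>M)"
          unfolding J_def
        proof (rule integral_mono)
          fix x
          have eq: "g x - u x = g x - v n x + t * - w x" by (simp add: u_def)
          show "huber (g x - u x) \<le> huber (g x - v n x) - t * (clip (g x - v n x) * w x)
             + t * (\<bar>w x\<bar> * min 2 (t * \<bar>w x\<bar>))"
            unfolding eq using huber_step[OF t, of "g x - v n x" "- w x"] by simp
        qed (use ih[OF uV] ih[OF vV] int_c int_\<rho> in auto)
        also have "\<dots> = J (v n) - t * (\<integral>x. clip (g x - v n x) * w x \<partial>M) + t * \<rho> t"
          unfolding J_def \<rho>_def using ih[OF vV[of n]] int_c[of n] int_\<rho> by simp
        finally show ?thesis by simp
      qed
      moreover have "(\<lambda>n. t * (\<integral>x. clip (g x - v n x) * w x \<partial>M)) \<longlonglongrightarrow> t * (\<integral>x. h x * w x \<partial>M)"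
        by (intro tendsto_intros L1)
      moreover have "(\<lambda>n. J (v n) - m + t * \<rho> t) \<longlonglongrightarrow> m - m + t * \<rho> t"
        by (intro tendsto_intros Jlim)
      ultimately have "t * (\<integral>x. h x * w x \<partial>M) \<le> t * \<rho> t"
        using LIMSEQ_le by fastforce
      then show ?thesis using t by simp
    qed
    have "(\<lambda>n. \<rho> (1 / real (Suc n))) \<longlonglongrightarrow> (\<integral>x. 0 \<partial>M)"
      unfolding \<rho>_def
    proof (rule integral_dominated_convergence[where w = "\<lambda>x. 2 * \<bar>w x\<bar>"])
      show "AE x in M. (\<lambda>n. \<bar>w x\<bar> * min 2 (1 / real (Suc n) * \<bar>w x\<bar>)) \<longlonglongrightarrow> 0"
      proof (rule AE_I2)
        fix x
        have "(\<lambda>n. \<bar>w x\<bar> * min 2 (1 / real (Suc n) * \<bar>w x\<bar>)) \<longlonglongrightarrow> \<bar>w x\<bar> * min 2 (0 * \<bar>w x\<bar>)"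
          by (intro tendsto_intros LIMSEQ_Suc[OF lim_1_over_n])
        then show "(\<lambda>n. \<bar>w x\<bar> * min 2 (1 / real (Suc n) * \<bar>w x\<bar>)) \<longlonglongrightarrow> 0" by simp
      qed
      show "AE x in M. norm (\<bar>w x\<bar> * min 2 (1 / real (Suc n) * \<bar>w x\<bar>)) \<le> 2 * \<bar>w x\<bar>" for n
        by (intro AE_I2) (auto simp: abs_mult mult.commute[of 2] intro!: mult_left_mono)
    qed (use int[OF w] in auto)
    then show ?thesis
      using LIMSEQ_le_const[of "\<lambda>n. \<rho> (1 / real (Suc n))" 0 "\<integral>x. h x * w x \<partial>M"] step by auto
  qed
  have "(\<integral>x. h x * w x \<partial>M) = 0" if w: "w \<in> V" for w
  proof -
    have "(\<lambda>x. (- 1) * w x + 0) \<in> V" by (intro V w)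
    from ann[OF this] ann[OF w] show ?thesis by simp
  qed
  with that[OF vV Jlim[unfolded m_def] hlim h_meas h_bd] show thesis by blast
qed

text \<open>
  Let \<open>m s\<close> be the infimum of \<open>\<integral> huber (s f - v)\<close> over \<open>v\<close> in \<open>V\<close>. Moving from \<open>s\<close> to \<open>s + t\<close> along a
  minimizing sequence at \<open>s\<close> changes the integral by \<open>t \<integral> h f\<close> up to \<open>o(t)\<close>, where \<open>h\<close> is the bounded
  annihilator of \<open>V\<close> provided by \<open>minimizing_residuals_converge\<close>. As \<open>f\<close> is killed by \<open>h\<close>, and
  as the error is uniform in \<open>s\<close>, summing \<open>n\<close> steps of length \<open>1 / n\<close> gives \<open>m 1 \<le> m 0 = 0\<close> in the limit. Finally
  \<open>abs_le_huber\<close> turns a small value of the functional into a small \<open>L1\<close> distance.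
\<close>

lemma (in finite_measure) L1_approx_if_annihilated:
  fixes f :: "'a \<Rightarrow> real"
  assumes V: "(\<lambda>x. 0) \<in> V" "\<And>a u v. u \<in> V \<Longrightarrow> v \<in> V \<Longrightarrow> (\<lambda>x. a * u x + v x) \<in> V"
    and int: "\<And>v. v \<in> V \<Longrightarrow> integrable M v" and f: "integrable M f"
    and ann: "\<And>h. h \<in> borel_measurable M \<Longrightarrow> (\<And>x. \<bar>h x\<bar> \<le> 1) \<Longrightarrow>
        (\<And>v. v \<in> V \<Longrightarrow> (\<integral>x. h x * v x \<partial>M) = 0) \<Longrightarrow> (\<integral>x. h x * f x \<partial>M) = 0"
    and "\<epsilon> > 0"
  shows "\<exists>v\<in>V. (\<integral>x. \<bar>f x - v x\<bar> \<partial>M) < \<epsilon>"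
proof -
  note [measurable] = borel_measurable_integrable[OF f] borel_measurable_integrable[OF int]
  define J where "J s v = (\<integral>x. huber (s * f x - v x) \<partial>M)" for s v
  define m where "m s = (INF v\<in>V. J s v)" for s
  define R where "R t = (\<integral>x. \<bar>f x\<bar> * min 2 (t * \<bar>f x\<bar>) \<partial>M)" for t
  have ne: "V \<noteq> {}" using V(1) by auto
  have ih: "integrable M (\<lambda>x. huber (s * f x - v x))" if "v \<in> V" for v s
    by (intro integrable_huber Bochner_Integration.integrable_diff integrable_mult_right f int that)
  have bdd: "bdd_below (J s ` V)" for s
    unfolding J_def by (intro bdd_belowI[of _ 0]) (auto intro!: Bochner_Integration.integral_nonneg huber_nonneg)
  have step: "m (s + t) \<le> m s + t * R t" if t: "t > 0" for s t
  proof -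
    obtain v h where v: "\<And>n::nat. v n \<in> V" and lim: "(\<lambda>n. J s (v n)) \<longlonglongrightarrow> m s"
      and ae: "AE x in M. (\<lambda>n. clip (s * f x - v n x)) \<longlonglongrightarrow> h x"
      and h [measurable]: "h \<in> borel_measurable M" and hb: "\<And>x. \<bar>h x\<bar> \<le> 1"
      and h0: "\<And>w. w \<in> V \<Longrightarrow> (\<integral>x. h x * w x \<partial>M) = 0"
      unfolding J_def m_def
      by (rule minimizing_residuals_converge[OF V int, of "\<lambda>x. s * f x"])
        (use f in auto)
    note [measurable] = borel_measurable_integrable[OF int[OF v]]
    have hf: "(\<integral>x. h x * f x \<partial>M) = 0" by (rule ann[OF h hb h0])
    have L1: "(\<lambda>n. \<integral>x. clip (s * f x - v n x) * f x \<partial>M) \<longlonglongrightarrow> (\<integral>x. h x * f x \<partial>M)"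
    proof (rule integral_dominated_convergence[where w = "\<lambda>x. \<bar>f x\<bar>"])
      show "AE x in M. (\<lambda>n. clip (s * f x - v n x) * f x) \<longlonglongrightarrow> h x * f x"
        using ae by eventually_elim (intro tendsto_intros)
      show "AE x in M. norm (clip (s * f x - v n x) * f x) \<le> \<bar>f x\<bar>" for n
        using abs_clip_le by (intro AE_I2) (auto simp: abs_mult intro!: mult_left_le_one_le)
    qed (use f in auto)
    have int_R: "integrable M (\<lambda>x. \<bar>f x\<bar> * min 2 (t * \<bar>f x\<bar>))"
    proof -
      have "integrable M (\<lambda>x. min 2 (t * \<bar>f x\<bar>) * \<bar>f x\<bar>)"
        by (rule integrable_bounded_mult[where C = 2]) (use f t in auto)
      then show ?thesis by (simp add: mult.commute)
    qed
    have int_c: "integrable M (\<lambda>x. clip (s * f x - v n x) * f x)" for n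
      by (rule integrable_bounded_mult[where C = 1]) (use f abs_clip_le in auto)
    have "m (s + t) \<le> J s (v n) + t * (\<integral>x. clip (s * f x - v n x) * f x \<partial>M) + t * R t" for n
    proof -
      have "m (s + t) \<le> J (s + t) (v n)" unfolding m_def by (rule cINF_lower[OF bdd v])
      also have "\<dots> \<le> (\<integral>x. huber (s * f x - v n x) + t * (clip (s * f x - v n x) * f x)
             + t * (\<bar>f x\<bar> * min 2 (t * \<bar>f x\<bar>)) \<partial>M)"
        unfolding J_def
      proof (rule integral_mono)
        fix x
        have eq: "(s + t) * f x - v n x = s * f x - v n x + t * f x" by (simp add: algebra_simps)
        show "huber ((s + t) * f x - v n x) \<le> huber (s * f x - v n x)
            + t * (clip (s * f x - v n x) * f x) + t * (\<bar>f x\<bar> * min 2 (t * \<bar>f x\<bar>))"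
          unfolding eq by (simp only: huber_step[OF t])
      qed (use ih[OF v] int_c int_R in auto)
      also have "\<dots> = J s (v n) + t * (\<integral>x. clip (s * f x - v n x) * f x \<partial>M) + t * R t"
        unfolding J_def R_def using ih[OF v[of n], of s] int_c[of n] int_R by simp
      finally show ?thesis .
    qed
    moreover have "(\<lambda>n. J s (v n) + t * (\<integral>x. clip (s * f x - v n x) * f x \<partial>M) + t * R t)
        \<longlonglongrightarrow> m s + t * (\<integral>x. h x * f x \<partial>M) + t * R t"
      by (intro tendsto_intros lim L1)
    ultimately show ?thesis using LIMSEQ_le_const by (fastforce simp: hf)
  qed
  have m1: "m 1 \<le> R (1 / real (Suc n))" for n
  proof -
    define t where "t = 1 / real (Suc n)"
    have t: "t > 0" by (simp add: t_def)
    have "m (real k * t) \<le> m 0 + real k * (t * R t)" for k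
    proof (induction k)
      case (Suc k)
      then show ?case using step[OF t, of "real k * t"] by (simp add: algebra_simps)
    qed simp
    from this[of "Suc n"] have "m 1 \<le> m 0 + R t"
      by (simp add: t_def del: of_nat_Suc)
    moreover have "m 0 \<le> J 0 (\<lambda>x. 0)" unfolding m_def by (rule cINF_lower[OF bdd V(1)])
    moreover have "J 0 (\<lambda>x. 0) = 0" by (simp add: J_def huber_def clip_def)
    ultimately show ?thesis by (simp add: t_def)
  qed
  have "(\<lambda>n. R (1 / real (Suc n))) \<longlonglongrightarrow> (\<integral>x. 0 \<partial>M)"
    unfolding R_def
  proof (rule integral_dominated_convergence[where w = "\<lambda>x. 2 * \<bar>f x\<bar>"])
    show "AE x in M. (\<lambda>n. \<bar>f x\<bar> * min 2 (1 / real (Suc n) * \<bar>f x\<bar>)) \<longlonglongrightarrow> 0"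
    proof (rule AE_I2)
      fix x
      have "(\<lambda>n. \<bar>f x\<bar> * min 2 (1 / real (Suc n) * \<bar>f x\<bar>)) \<longlonglongrightarrow> \<bar>f x\<bar> * min 2 (0 * \<bar>f x\<bar>)"
        by (intro tendsto_intros LIMSEQ_Suc[OF lim_1_over_n])
      then show "(\<lambda>n. \<bar>f x\<bar> * min 2 (1 / real (Suc n) * \<bar>f x\<bar>)) \<longlonglongrightarrow> 0" by simp
    qed
    show "AE x in M. norm (\<bar>f x\<bar> * min 2 (1 / real (Suc n) * \<bar>f x\<bar>)) \<le> 2 * \<bar>f x\<bar>" for n
      by (intro AE_I2) (auto simp: abs_mult mult.commute[of 2] intro!: mult_left_mono)
  qed (use f in auto)
  then have "m 1 \<le> 0" using LIMSEQ_le_const[of "\<lambda>n. R (1 / real (Suc n))" 0 "m 1"] m1 by auto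
  define \<mu> where "\<mu> = measure M (space M) + 1"
  have \<mu>: "\<mu> \<ge> 1" by (simp add: \<mu>_def)
  define \<eta> where "\<eta> = min 1 (\<epsilon> / (2 * \<mu>))"
  have \<eta>: "0 < \<eta>" "\<eta> \<le> 1" "\<eta> * \<mu> \<le> \<epsilon> / 2"
    using \<mu> \<open>\<epsilon> > 0\<close> by (auto simp: \<eta>_def min_def field_simps)
  have "m 1 < \<epsilon> * \<eta> / 4" using \<open>m 1 \<le> 0\<close> \<eta> \<open>\<epsilon> > 0\<close> by (smt (verit) divide_pos_pos mult_pos_pos)
  then obtain v where v: "v \<in> V" "J 1 v < \<epsilon> * \<eta> / 4"
    using cINF_less_iff[OF ne bdd] unfolding m_def by blast
  have "(\<integral>x. \<bar>f x - v x\<bar> \<partial>M) \<le> (\<integral>x. \<eta> + 2 / \<eta> * huber (1 * f x - v x) \<partial>M)"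
    by (rule integral_mono) (use f int[OF v(1)] ih[OF v(1), of 1] abs_le_huber[OF \<eta>(1,2)] in auto)
  also have "\<dots> = \<eta> * measure M (space M) + 2 / \<eta> * J 1 v"
    unfolding J_def using ih[OF v(1), of 1] by simp
  also have "\<dots> < \<eta> * \<mu> + 2 / \<eta> * (\<epsilon> * \<eta> / 4)"
    using v(2) \<eta> by (intro add_le_less_mono mult_left_mono mult_strict_left_mono) (auto simp: \<mu>_def)
  also have "\<dots> \<le> \<epsilon>" using \<eta> by (simp add: field_simps)
  finally show ?thesis using v(1) by blast
qed

section \<open>Hahn decomposition and the Radon-Nikodym theorem for signed measures\<close>

lemma signed_measuresD:
  assumes "Q \<in> signed_measures M"
  shows "Q {} = 0"
    and "\<And>A. range A \<subseteq> sets M \<Longrightarrow> disjoint_family A \<Longrightarrow> (\<lambda>i::nat. Q (A i)) sums Q (\<Union>i. A i)"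
  using assms by (auto simp: signed_measures_def)

lemma signed_measure_Un:
  assumes Q: "Q \<in> signed_measures M" and "A \<in> sets M" "B \<in> sets M" "A \<inter> B = {}"
  shows "Q (A \<union> B) = Q A + Q B"
proof -
  have "(\<lambda>i. Q (binaryset A B i)) sums Q (\<Union>i. binaryset A B i)"
    using assms by (intro signed_measuresD(2)[OF Q])
      (auto simp: range_binaryset_eq disjoint_family_on_def binaryset_def)
  moreover have "(\<lambda>i. Q (binaryset A B i)) sums (Q A + Q B)"
    by (rule binaryset_sums) (rule signed_measuresD(1)[OF Q])
  ultimately show ?thesis
    using sums_unique2 by (fastforce simp: UN_binaryset_eq)
qed

lemma signed_measure_Diff:
  assumes Q: "Q \<in> signed_measures M" and "A \<in> sets M" "B \<in> sets M" "B \<subseteq> A"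
  shows "Q (A - B) = Q A - Q B"
proof -
  have "Q ((A - B) \<union> B) = Q (A - B) + Q B"
    using assms by (intro signed_measure_Un[OF Q]) auto
  then show ?thesis using assms by (simp add: Un_absorb2)
qed

text \<open>
  Otherwise sets of measure less than \<open>-\<epsilon>\<close> could be removed from \<open>A\<close> over and over again, as each
  removal increases the measure of the rest. They are disjoint, so their measures would form a
  convergent series whose terms do not tend to zero.
\<close>

lemma signed_measure_subset_almost_nonneg:
  assumes Q: "Q \<in> signed_measures M" and A: "A \<in> sets M" and "\<epsilon> > 0"
  shows "\<exists>B\<in>sets M. B \<subseteq> A \<and> Q A \<le> Q B \<and> (\<forall>E\<in>sets M. E \<subseteq> B \<longrightarrow> - \<epsilon> \<le> Q E)"
proof (rule ccontr)
  assume "\<not> ?thesis"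
  then have "\<forall>B. \<exists>E. B \<in> sets M \<and> B \<subseteq> A \<and> Q A \<le> Q B \<longrightarrow> E \<in> sets M \<and> E \<subseteq> B \<and> Q E < - \<epsilon>"
    by (meson not_le)
  then obtain e where e: "\<And>B. B \<in> sets M \<Longrightarrow> B \<subseteq> A \<Longrightarrow> Q A \<le> Q B \<Longrightarrow>
      e B \<in> sets M \<and> e B \<subseteq> B \<and> Q (e B) < - \<epsilon>"
    by metis
  define B where "B n = ((\<lambda>X. X - e X) ^^ n) A" for n
  have B_Suc: "B (Suc n) = B n - e (B n)" for n by (simp add: B_def)
  have B: "B n \<in> sets M \<and> B n \<subseteq> A \<and> Q A \<le> Q (B n)" for n
  proof (induction n)
    case (Suc n)
    then show ?case
      using e[of "B n"] signed_measure_Diff[OF Q, of "B n" "e (B n)"] \<open>\<epsilon> > 0\<close> by (auto simp: B_Suc)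
  qed (use A in \<open>auto simp: B_def\<close>)
  define E where "E n = e (B n)" for n
  have E: "E n \<in> sets M" "E n \<subseteq> B n" "Q (E n) < - \<epsilon>" for n
    using e[of "B n"] B[of n] by (auto simp: E_def)
  have dec: "B n \<subseteq> B m" if "m \<le> n" for m n
    using that by (induction n rule: dec_induct) (auto simp: B_Suc)
  have "E m \<inter> E n = {}" if "m < n" for m n
    using dec[of "Suc m" n] E(2)[of n] that by (auto simp: B_Suc E_def)
  then have "disjoint_family E"
    unfolding disjoint_family_on_def by (metis Int_commute linorder_neqE_nat)
  then have "(\<lambda>i. Q (E i)) sums Q (\<Union>i. E i)"
    using E by (intro signed_measuresD(2)[OF Q]) auto
  then have "(\<lambda>i. Q (E i)) \<longlonglongrightarrow> 0"
    by (rule summable_LIMSEQ_zero[OF sums_summable])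
  then have "0 \<le> - \<epsilon>"
    by (rule LIMSEQ_le_const2) (use E(3) in \<open>auto intro: less_imp_le\<close>)
  with \<open>\<epsilon> > 0\<close> show False by simp
qed

definition positive_set :: "'a measure \<Rightarrow> ('a set \<Rightarrow> real) \<Rightarrow> 'a set \<Rightarrow> bool" where
  "positive_set M Q B \<longleftrightarrow> B \<in> sets M \<and> (\<forall>E\<in>sets M. E \<subseteq> B \<longrightarrow> 0 \<le> Q E)"

text \<open>
  Intersect the sets that \<open>signed_measure_subset_almost_nonneg\<close> yields successively for
  \<open>\<epsilon> = 1, 1/2, 1/3, \<dots>\<close>. The parts removed have nonpositive measure, and so has their union.
\<close>

lemma positive_subset:
  assumes Q: "Q \<in> signed_measures M" and A: "A \<in> sets M"
  shows "\<exists>B. positive_set M Q B \<and> B \<subseteq> A \<and> Q A \<le> Q B"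
proof -
  have "\<forall>n::nat. \<forall>A. \<exists>B. A \<in> sets M \<longrightarrow> B \<in> sets M \<and> B \<subseteq> A \<and> Q A \<le> Q B
      \<and> (\<forall>E\<in>sets M. E \<subseteq> B \<longrightarrow> - (1 / real (Suc n)) \<le> Q E)"
  proof (intro allI)
    fix n :: nat and A
    have "0 < 1 / real (Suc n)" by simp
    from signed_measure_subset_almost_nonneg[OF Q _ this, of A]
    show "\<exists>B. A \<in> sets M \<longrightarrow> B \<in> sets M \<and> B \<subseteq> A \<and> Q A \<le> Q B
      \<and> (\<forall>E\<in>sets M. E \<subseteq> B \<longrightarrow> - (1 / real (Suc n)) \<le> Q E)" by blast
  qed
  then obtain s where s: "\<And>n A. A \<in> sets M \<Longrightarrow> s n A \<in> sets M \<and> s n A \<subseteq> A \<and> Q A \<le> Q (s n A)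
      \<and> (\<forall>E\<in>sets M. E \<subseteq> s n A \<longrightarrow> - (1 / real (Suc n)) \<le> Q E)"
    by metis
  define B where "B n = rec_nat A s n" for n
  have B0: "B 0 = A" and B_Suc: "B (Suc n) = s n (B n)" for n by (simp_all add: B_def)
  have B_sets: "B n \<in> sets M" for n by (induction n) (use A s in \<open>auto simp: B0 B_Suc\<close>)
  have B: "B (Suc n) \<subseteq> B n" "Q (B n) \<le> Q (B (Suc n))"
    "E \<in> sets M \<Longrightarrow> E \<subseteq> B (Suc n) \<Longrightarrow> - (1 / real (Suc n)) \<le> Q E" for n E
    using s[OF B_sets[of n], of n] unfolding B_Suc by auto
  define C where "C = (\<Inter>n. B n)"
  have C: "C \<in> sets M" "C \<subseteq> A" using B_sets B0 by (auto simp: C_def)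
  have dec: "B n \<subseteq> B m" if "m \<le> n" for m n
    using that B(1) by (rule_tac lift_Suc_antimono_le[of B]) auto
  have "0 \<le> Q E" if "E \<in> sets M" "E \<subseteq> C" for E
  proof -
    have "(\<lambda>n. - (1 / real (Suc n))) \<longlonglongrightarrow> - 0"
      by (intro tendsto_minus LIMSEQ_Suc[OF lim_1_over_n])
    moreover have "\<forall>n\<ge>0. - (1 / real (Suc n)) \<le> Q E" using that by (intro allI impI B(3)) (auto simp: C_def)
    ultimately show ?thesis using LIMSEQ_le_const2[of _ "- 0" "Q E"] by auto
  qed
  moreover have "Q A \<le> Q C"
  proof -
    define D where "D n = B n - B (Suc n)" for n
    have D: "D n \<in> sets M" "Q (D n) \<le> 0" for n
      using B_sets B(2)[of n] signed_measure_Diff[OF Q B_sets[of n] B_sets[of "Suc n"] B(1)]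
      by (auto simp: D_def)
    have "D m \<inter> D n = {}" if "m < n" for m n
      using dec[of "Suc m" n] that by (auto simp: D_def)
    then have "disjoint_family D"
      unfolding disjoint_family_on_def by (metis Int_commute linorder_neqE_nat)
    then have "(\<lambda>i. Q (D i)) sums Q (\<Union>i. D i)"
      using D by (intro signed_measuresD(2)[OF Q]) auto
    then have "Q (\<Union>i. D i) \<le> 0"
      by (rule sums_le[OF D(2) _ sums_zero])
    moreover have "(\<Union>i. D i) = A - C"
    proof (intro equalityI subsetI)
      fix x assume "x \<in> A - C"
      then obtain k where k: "x \<notin> B k" "x \<in> B 0" by (auto simp: C_def B0)
      define j where "j = (LEAST k. x \<notin> B k)"
      have j: "x \<notin> B j" unfolding j_def using k by (rule_tac LeastI)
      then obtain i where i: "j = Suc i" using k by (cases j) auto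
      have "x \<in> B i" using not_less_Least[of i "\<lambda>k. x \<notin> B k"] i by (auto simp: j_def[symmetric])
      then show "x \<in> (\<Union>i. D i)" using j i by (auto simp: D_def)
    qed (use dec[of 0] in \<open>auto simp: D_def C_def B0\<close>)
    ultimately show ?thesis using signed_measure_Diff[OF Q A C] by simp
  qed
  ultimately show ?thesis using C by (auto simp: positive_set_def)
qed

lemma positive_set_UN:
  assumes Q: "Q \<in> signed_measures M" and B: "\<And>n::nat. positive_set M Q (B n)"
  shows "positive_set M Q (\<Union>n. B n)"
  unfolding positive_set_def
proof (intro conjI ballI impI)
  show "(\<Union>n. B n) \<in> sets M" using B by (auto simp: positive_set_def)
  fix E assume E: "E \<in> sets M" "E \<subseteq> (\<Union>n. B n)"
  have sub: "disjointed B n \<subseteq> B n" for n by (rule disjointed_subset)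
  have "range (disjointed B) \<subseteq> sets M"
    using B by (intro sets.range_disjointed_sets) (auto simp: positive_set_def)
  then have m: "E \<inter> disjointed B n \<in> sets M" for n using E by auto
  have "(\<lambda>n. Q (E \<inter> disjointed B n)) sums Q (\<Union>n. E \<inter> disjointed B n)"
    using m disjoint_family_disjointed[of B]
    by (intro signed_measuresD(2)[OF Q]) (auto simp: disjoint_family_on_def)
  moreover have "(\<Union>n. E \<inter> disjointed B n) = E" using E UN_disjointed_eq[of B] by auto
  moreover have "0 \<le> Q (E \<inter> disjointed B n)" for n
    using B[of n] m[of n] sub[of n] unfolding positive_set_def by (meson Int_lower2 subset_trans)
  ultimately show "0 \<le> Q E" using sums_le[OF _ sums_zero, of "\<lambda>n. Q (E \<inter> disjointed B n)" "Q E"] by simp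
qed

text \<open>
  A positive set of maximal measure exists since positive sets are closed under countable unions.
  A set of positive measure disjoint from it would contain a positive subset to enlarge it with.
  The supremum is taken in the extended reals, as boundedness of \<open>Q\<close> is only known afterwards.
\<close>

lemma Hahn_decomposition:
  assumes Q: "Q \<in> signed_measures M"
  obtains H where "positive_set M Q H" "\<And>E. E \<in> sets M \<Longrightarrow> E \<inter> H = {} \<Longrightarrow> Q E \<le> 0"
proof -
  let ?S = "(\<lambda>B. ereal (Q B)) ` {B. positive_set M Q B}"
  have "?S \<noteq> {}"
    using signed_measuresD(1)[OF Q] by (auto simp: positive_set_def intro!: exI[of _ "{}"])
  then obtain f :: "nat \<Rightarrow> ereal" where f: "range f \<subseteq> ?S" "Sup ?S = (SUP i. f i)"
    using Sup_countable_SUP by metis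
  then have "\<forall>n. \<exists>B. positive_set M Q B \<and> f n = ereal (Q B)" by (auto simp: image_subset_iff)
  then obtain B where B: "\<And>n. positive_set M Q (B n)" "\<And>n. f n = ereal (Q (B n))" by metis
  define H where "H = (\<Union>n. B n)"
  have H: "positive_set M Q H" unfolding H_def by (rule positive_set_UN[OF Q B(1)])
  have "Q (B n) \<le> Q H" for n
  proof -
    have "B n \<in> sets M" "H \<in> sets M" "B n \<subseteq> H" using B H by (auto simp: positive_set_def H_def)
    moreover from this have "0 \<le> Q (H - B n)" using H by (auto simp: positive_set_def)
    ultimately show ?thesis using signed_measure_Diff[OF Q] by simp
  qed
  then have "Sup ?S \<le> ereal (Q H)" by (simp add: f(2) B(2) SUP_le_iff)
  then have max: "Q B \<le> Q H" if "positive_set M Q B" for B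
    using that by (simp add: Sup_le_iff)
  have "Q E \<le> 0" if E: "E \<in> sets M" "E \<inter> H = {}" for E
  proof -
    obtain C where C: "positive_set M Q C" "C \<subseteq> E" "Q E \<le> Q C"
      using positive_subset[OF Q E(1)] by blast
    have "positive_set M Q {}" using signed_measuresD(1)[OF Q] by (simp add: positive_set_def)
    then have "positive_set M Q (binaryset H C n)" for n
      using H C(1) by (simp add: binaryset_def)
    then have "positive_set M Q (\<Union>n. binaryset H C n)"
      by (rule positive_set_UN[OF Q])
    then have "Q (H \<union> C) \<le> Q H" by (simp add: UN_binaryset_eq max)
    moreover have "Q (H \<union> C) = Q H + Q C"
    proof (rule signed_measure_Un[OF Q])
      show "H \<in> sets M" "C \<in> sets M" using H C(1) by (simp_all add: positive_set_def)
      show "H \<inter> C = {}" using C(2) E(2) by blast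
    qed
    ultimately show ?thesis using C(3) by simp
  qed
  with that H show thesis by blast
qed

lemma (in prob_space) Radon_Nikodym_nonneg:
  assumes Q: "Q \<in> ac_signed_measures M" and nn: "\<And>A. A \<in> sets M \<Longrightarrow> 0 \<le> Q A"
  shows "\<exists>q. integrable M q \<and> (\<forall>A\<in>sets M. Q A = (LINT x:A|M. q x))"
proof -
  have S: "Q \<in> signed_measures M" using Q by (simp add: ac_signed_measures_def)
  define N where "N = measure_of (space M) (sets M) (\<lambda>A. ennreal (Q A))"
  have sN: "sets N = sets M" by (simp add: N_def)
  have eN: "emeasure N A = ennreal (Q A)" if "A \<in> sets M" for A
  proof (rule emeasure_measure_of[OF N_def])
    show "countably_additive (sets N) (\<lambda>A. ennreal (Q A))"
      unfolding sN
      by (intro countably_additiveI suminf_ennreal_eq nn signed_measuresD(2)[OF S]) auto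
    show "positive (sets N) (\<lambda>A. ennreal (Q A))"
      by (simp add: positive_def signed_measuresD(1)[OF S])
  qed (use that sN sets.sets_into_space in auto)
  have "absolutely_continuous M N"
    using Q eN sN unfolding absolutely_continuous_def null_sets_def ac_signed_measures_def by auto
  then obtain f where f [measurable]: "f \<in> borel_measurable M" and fN: "density M f = N"
    using Radon_Nikodym sN by blast
  have nnf: "(\<integral>\<^sup>+x. f x * indicator A x \<partial>M) = ennreal (Q A)" if "A \<in> sets M" for A
    using eN[OF that] that unfolding fN[symmetric] by (simp add: emeasure_density)
  have "(\<integral>\<^sup>+x. f x \<partial>M) = (\<integral>\<^sup>+x. f x * indicator (space M) x \<partial>M)"
    by (intro nn_integral_cong) auto
  then have fin: "(\<integral>\<^sup>+x. f x \<partial>M) < \<infinity>" using nnf[of "space M"] by simp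
  then have ae: "AE x in M. f x = ennreal (enn2real (f x))"
    using nn_integral_PInf_AE[OF f] by (auto simp: less_top[symmetric] elim!: eventually_mono)
  have int: "integrable M (\<lambda>x. enn2real (f x))"
  proof (rule integrableI_nonneg)
    have "(\<integral>\<^sup>+x. ennreal (enn2real (f x)) \<partial>M) = (\<integral>\<^sup>+x. f x \<partial>M)"
      using ae by (intro nn_integral_cong_AE) auto
    then show "(\<integral>\<^sup>+x. ennreal (enn2real (f x)) \<partial>M) < \<infinity>" using fin by simp
  qed auto
  moreover have "Q A = (LINT x:A|M. enn2real (f x))" if A [measurable]: "A \<in> sets M" for A
  proof -
    have "ennreal (LINT x:A|M. enn2real (f x)) = (\<integral>\<^sup>+x. ennreal (indicator A x * enn2real (f x)) \<partial>M)"
      unfolding set_lebesgue_integral_def real_scaleR_def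
      by (rule nn_integral_eq_integral[symmetric])
        (use integrable_mult_indicator[OF A int] in auto)
    also have "\<dots> = (\<integral>\<^sup>+x. f x * indicator A x \<partial>M)"
      using ae by (intro nn_integral_cong_AE) (auto elim!: eventually_mono simp: indicator_def)
    also have "\<dots> = ennreal (Q A)" by (rule nnf[OF A])
    finally show ?thesis
      using nn[OF A] by (subst (asm) ennreal_inj)
        (auto simp: set_lebesgue_integral_def intro!: Bochner_Integration.integral_nonneg)
  qed
  ultimately show ?thesis by blast
qed

lemma ac_signed_measure_trace:
  assumes Q: "Q \<in> ac_signed_measures M" and H: "H \<in> sets M"
  shows "(\<lambda>A. if A \<in> sets M then c * Q (A \<inter> H) else 0) \<in> ac_signed_measures M"
proof -
  have S: "Q \<in> signed_measures M" and N: "\<And>A. A \<in> null_sets M \<Longrightarrow> Q A = 0"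
    using Q by (auto simp: ac_signed_measures_def)
  have "(\<lambda>i. c * Q (A i \<inter> H)) sums (c * Q ((\<Union>i. A i) \<inter> H))"
    if A: "range A \<subseteq> sets M" "disjoint_family A" for A :: "nat \<Rightarrow> _"
  proof -
    have "(\<lambda>i. Q (A i \<inter> H)) sums Q (\<Union>i. A i \<inter> H)"
      using A H by (intro signed_measuresD(2)[OF S]) (auto simp: disjoint_family_on_def)
    then show ?thesis using sums_mult[of _ _ c] by simp
  qed
  note sums = this
  let ?R = "\<lambda>A. if A \<in> sets M then c * Q (A \<inter> H) else 0"
  have r1: "(\<lambda>i. ?R (A i)) sums ?R (\<Union>i. A i)"
    if A: "range A \<subseteq> sets M" "disjoint_family A" for A :: "nat \<Rightarrow> _"
  proof -
    have "A i \<in> sets M" for i using A by auto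
    moreover have "(\<Union>i. A i) \<in> sets M" using A(1) by (rule sets.countable_UN)
    ultimately show ?thesis using sums[OF A] by (simp only: if_True)
  qed
  have r2: "?R A = 0" if "A \<in> null_sets M" for A
    using N[OF null_set_Int2[OF that H]] by simp
  have r3: "?R {} = 0" by (simp add: signed_measuresD(1)[OF S])
  have r4: "?R A = 0" if "A \<notin> sets M" for A using that by simp
  show ?thesis
    unfolding ac_signed_measures_def signed_measures_def
    by (intro CollectI conjI allI impI ballI r1 r2 r3 r4)
qed

lemma (in prob_space) signed_Radon_Nikodym:
  assumes Q: "Q \<in> ac_signed_measures M"
  shows "\<exists>q. integrable M q \<and> (\<forall>A\<in>sets M. Q A = (LINT x:A|M. q x))"
proof -
  have S: "Q \<in> signed_measures M" using Q by (simp add: ac_signed_measures_def)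
  obtain H where H: "positive_set M Q H" and neg: "\<And>E. E \<in> sets M \<Longrightarrow> E \<inter> H = {} \<Longrightarrow> Q E \<le> 0"
    using Hahn_decomposition[OF S] by blast
  have Hs: "H \<in> sets M" using H by (simp add: positive_set_def)
  let ?Q1 = "\<lambda>A. if A \<in> sets M then 1 * Q (A \<inter> H) else 0"
  let ?Q2 = "\<lambda>A. if A \<in> sets M then - 1 * Q (A \<inter> (space M - H)) else 0"
  have "0 \<le> ?Q1 A" if "A \<in> sets M" for A
    using H that Hs by (auto simp: positive_set_def)
  then obtain q1 where q1: "integrable M q1" "\<And>A. A \<in> sets M \<Longrightarrow> ?Q1 A = (LINT x:A|M. q1 x)"
    using Radon_Nikodym_nonneg[OF ac_signed_measure_trace[OF Q Hs, of 1]] by blast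
  have "0 \<le> ?Q2 A" if "A \<in> sets M" for A
  proof -
    have "Q (A \<inter> (space M - H)) \<le> 0" using that Hs by (intro neg) auto
    then show ?thesis by simp
  qed
  then obtain q2 where q2: "integrable M q2" "\<And>A. A \<in> sets M \<Longrightarrow> ?Q2 A = (LINT x:A|M. q2 x)"
    using Radon_Nikodym_nonneg[OF ac_signed_measure_trace[OF Q, of "space M - H" "- 1"]] Hs by blast
  show ?thesis
  proof (intro exI[of _ "\<lambda>x. q1 x - q2 x"] conjI ballI)
    show "integrable M (\<lambda>x. q1 x - q2 x)" using q1 q2 by simp
    fix A assume A: "A \<in> sets M"
    have "Q A = Q ((A \<inter> H) \<union> (A \<inter> (space M - H)))"
      using A sets.sets_into_space by (intro arg_cong[of _ _ Q]) auto
    also have "\<dots> = Q (A \<inter> H) + Q (A \<inter> (space M - H))"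
      using A Hs by (intro signed_measure_Un[OF S]) auto
    also have "\<dots> = (LINT x:A|M. q1 x) - (LINT x:A|M. q2 x)"
      using q1(2)[OF A] q2(2)[OF A] A by simp
    also have "\<dots> = (LINT x:A|M. q1 x - q2 x)"
      using integrable_mult_indicator[OF A q1(1)] integrable_mult_indicator[OF A q2(1)]
      by (subst set_integral_diff) (simp_all add: set_integrable_def)
    finally show "Q A = (LINT x:A|M. q1 x - q2 x)" .
  qed
qed

section \<open>Jordan components and constraints in terms of densities\<close>

text \<open>
  A density determines \<open>Q\<close> only up to its values off \<open>sets M\<close>, and it is not unique itself; a relation
  lets the results below be used for densities other than the chosen one \<open>density_of\<close>.
\<close>

definition signed_density :: "'a measure \<Rightarrow> ('a set \<Rightarrow> real) \<Rightarrow> ('a \<Rightarrow> real) \<Rightarrow> bool" where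
  "signed_density M Q q \<longleftrightarrow> integrable M q \<and> (\<forall>A\<in>sets M. Q A = (LINT x:A|M. q x))"

lemma (in prob_space) signed_density_density_of:
  assumes "Q \<in> ac_signed_measures M"
  shows "signed_density M Q (density_of M Q)"
  unfolding signed_density_def density_of_def
  using signed_Radon_Nikodym[OF assms] by (rule someI_ex)

lemma signed_density_minus:
  "signed_density M Q q \<Longrightarrow> signed_density M (\<lambda>A. - Q A) (\<lambda>x. - q x)"
  by (auto simp: signed_density_def set_lebesgue_integral_def)

lemma signed_density_unique:
  assumes "signed_density M Q q" "signed_density M Q q'"
  shows "AE x in M. q x = q' x"
  using assms by (intro density_unique_real) (auto simp: signed_density_def)

text \<open>
  The supremum over measurable subsets of \<open>A\<close> is attained at the part of \<open>A\<close> where \<open>q\<close> is nonnegative.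
\<close>

lemma pos_part_eq_density:
  assumes q: "signed_density M Q q"
  shows "pos_part M Q = density M (\<lambda>x. ennreal (max 0 (q x)))"
  unfolding pos_part_def density_def
proof (rule measure_of_eq[OF sets.space_closed])
  fix A assume "A \<in> sigma_sets (space M) (sets M)"
  then have A [measurable]: "A \<in> sets M" by (simp add: sets.sigma_sets_eq)
  have int: "integrable M q" and Q: "\<And>A. A \<in> sets M \<Longrightarrow> Q A = (\<integral>x. indicator A x * q x \<partial>M)"
    using q by (auto simp: signed_density_def set_lebesgue_integral_def)
  note [measurable] = borel_measurable_integrable[OF int]
  have int_A: "integrable M (\<lambda>x. indicator A x * max 0 (q x))"
    using integrable_mult_indicator[OF A, of "\<lambda>x. max 0 (q x)"] int by simp
  have eq: "(\<integral>\<^sup>+x. ennreal (max 0 (q x)) * indicator A x \<partial>M)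
      = ennreal (\<integral>x. indicator A x * max 0 (q x) \<partial>M)"
    by (subst nn_integral_eq_integral[OF int_A, symmetric])
      (auto intro!: nn_integral_cong simp: indicator_def)
  show "(SUP B\<in>{B \<in> sets M. B \<subseteq> A}. ennreal (Q B)) = (\<integral>\<^sup>+x. ennreal (max 0 (q x)) * indicator A x \<partial>M)"
  proof (rule antisym)
    show "(SUP B\<in>{B \<in> sets M. B \<subseteq> A}. ennreal (Q B)) \<le> (\<integral>\<^sup>+x. ennreal (max 0 (q x)) * indicator A x \<partial>M)"
    proof (rule SUP_least)
      fix B assume B: "B \<in> {B \<in> sets M. B \<subseteq> A}"
      have "integrable M (\<lambda>x. indicator B x * q x)"
        using integrable_mult_indicator[of B M q] int B by simp
      then have "Q B \<le> (\<integral>x. indicator A x * max 0 (q x) \<partial>M)"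
        using B int_A by (subst Q) (auto intro!: integral_mono simp: indicator_def)
      then show "ennreal (Q B) \<le> (\<integral>\<^sup>+x. ennreal (max 0 (q x)) * indicator A x \<partial>M)"
        unfolding eq by (rule ennreal_leI)
    qed
    define B where "B = A \<inter> {x \<in> space M. 0 \<le> q x}"
    have B: "B \<in> sets M" "B \<subseteq> A" by (auto simp: B_def)
    have "Q B = (\<integral>x. indicator A x * max 0 (q x) \<partial>M)"
      unfolding Q[OF B(1)]
      by (rule Bochner_Integration.integral_cong) (auto simp: B_def indicator_def max_def)
    then have "(\<integral>\<^sup>+x. ennreal (max 0 (q x)) * indicator A x \<partial>M) = ennreal (Q B)"
      unfolding eq by simp
    also have "\<dots> \<le> (SUP B\<in>{B \<in> sets M. B \<subseteq> A}. ennreal (Q B))"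
      using B by (intro SUP_upper) auto
    finally show "(\<integral>\<^sup>+x. ennreal (max 0 (q x)) * indicator A x \<partial>M) \<le> (SUP B\<in>{B \<in> sets M. B \<subseteq> A}. ennreal (Q B))" .
  qed
qed

lemma neg_part_eq_density:
  assumes "signed_density M Q q"
  shows "neg_part M Q = density M (\<lambda>x. ennreal (max 0 (- q x)))"
  unfolding neg_part_def by (rule pos_part_eq_density[OF signed_density_minus[OF assms]])

lemma total_var_eq_density:
  assumes q: "signed_density M Q q"
  shows "total_var M Q = density M (\<lambda>x. ennreal \<bar>q x\<bar>)"
proof -
  have [measurable]: "q \<in> borel_measurable M" using q by (auto simp: signed_density_def)
  show ?thesis
    unfolding total_var_def pos_part_eq_density[OF q] neg_part_eq_density[OF q]
    unfolding density_def[of M "\<lambda>x. ennreal \<bar>q x\<bar>"]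
  proof (rule measure_of_eq[OF sets.space_closed])
    fix A assume "A \<in> sigma_sets (space M) (sets M)"
    then have A [measurable]: "A \<in> sets M" by (simp add: sets.sigma_sets_eq)
    show "emeasure (density M (\<lambda>x. ennreal (max 0 (q x)))) A + emeasure (density M (\<lambda>x. ennreal (max 0 (- q x)))) A
        = (\<integral>\<^sup>+x. ennreal \<bar>q x\<bar> * indicator A x \<partial>M)"
      by (subst (1 2) emeasure_density, simp_all add: nn_integral_add[symmetric])
        (auto intro!: nn_integral_cong simp: indicator_def abs_if ennreal_neg)
  qed
qed

lemma integrable_total_var_iff:
  assumes q: "signed_density M Q q" and [measurable]: "g \<in> borel_measurable M"
  shows "integrable (total_var M Q) g \<longleftrightarrow> integrable M (\<lambda>x. g x * q x)"
proof -
  have [measurable]: "q \<in> borel_measurable M" using q by (auto simp: signed_density_def)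
  have "integrable (total_var M Q) g \<longleftrightarrow> integrable M (\<lambda>x. \<bar>q x\<bar> *\<^sub>R g x)"
    unfolding total_var_eq_density[OF q] by (rule integrable_density) auto
  also have "\<dots> \<longleftrightarrow> integrable M (\<lambda>x. g x * q x)"
    by (subst (1 2) integrable_abs_iff[symmetric]) (simp_all add: abs_mult mult.commute)
  finally show ?thesis .
qed

lemma integral_total_var:
  assumes q: "signed_density M Q q" and "g \<in> borel_measurable M"
  shows "(\<integral>x. g x \<partial>total_var M Q) = (\<integral>x. \<bar>q x\<bar> * g x \<partial>M)"
proof -
  have "q \<in> borel_measurable M" using q by (auto simp: signed_density_def)
  then show ?thesis
    unfolding total_var_eq_density[OF q] using assms by (subst integral_density) auto
qed

lemma nn_integral_total_var_finite_iff:
  assumes q: "signed_density M Q q" and g: "g \<in> borel_measurable M"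
  shows "(\<integral>\<^sup>+x. ennreal \<bar>g x\<bar> \<partial>total_var M Q) < \<infinity> \<longleftrightarrow> integrable M (\<lambda>x. g x * q x)"
proof -
  have "g \<in> borel_measurable (total_var M Q)"
    unfolding total_var_eq_density[OF q] using g by simp
  then have "integrable (total_var M Q) g \<longleftrightarrow> (\<integral>\<^sup>+x. ennreal \<bar>g x\<bar> \<partial>total_var M Q) < \<infinity>"
    by (simp add: integrable_iff_bounded)
  then show ?thesis by (simp only: integrable_total_var_iff[OF assms])
qed

lemma signed_integral_eq:
  assumes q: "signed_density M Q q" and [measurable]: "g \<in> borel_measurable M"
    and int: "integrable M (\<lambda>x. g x * q x)"
  shows "signed_integral M Q g = (\<integral>x. g x * q x \<partial>M)"
proof -
  have [measurable]: "q \<in> borel_measurable M" using q by (auto simp: signed_density_def)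
  have "integrable M (\<lambda>x. max 0 (q x) * g x)" "integrable M (\<lambda>x. max 0 (- q x) * g x)"
    by (rule Bochner_Integration.integrable_bound[OF int];
        auto intro!: AE_I2 mult_right_mono simp: abs_mult mult.commute[of "g _"])+
  then have "(\<integral>x. max 0 (q x) * g x \<partial>M) - (\<integral>x. max 0 (- q x) * g x \<partial>M)
      = (\<integral>x. max 0 (q x) * g x - max 0 (- q x) * g x \<partial>M)" by simp
  also have "\<dots> = (\<integral>x. g x * q x \<partial>M)"
    by (rule Bochner_Integration.integral_cong) (auto simp: max_def)
  moreover have "integral\<^sup>L (pos_part M Q) g = (\<integral>x. max 0 (q x) * g x \<partial>M)"
    "integral\<^sup>L (neg_part M Q) g = (\<integral>x. max 0 (- q x) * g x \<partial>M)"
    unfolding pos_part_eq_density[OF q] neg_part_eq_density[OF q]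
    by (subst integral_density; simp)+
  ultimately show ?thesis unfolding signed_integral_def by simp
qed

text \<open>
  The form in which membership is used: the constraints are linear in the density.
\<close>

lemma constraint_set_iff:
  assumes q: "signed_density P Q q" and G: "G \<subseteq> borel_measurable P" and "indicat_real (space P) \<in> G"
    and "Q \<in> ac_signed_measures P"
  shows "Q \<in> constraint_set G P \<longleftrightarrow> (\<forall>g\<in>G. integrable P (\<lambda>x. g x * q x) \<and>
      (\<integral>x. g x * q x \<partial>P) = (if g = indicat_real (space P) then 1 else 0))"
proof -
  have "(\<integral>\<^sup>+x. ennreal \<bar>g x\<bar> \<partial>total_var P Q) < \<infinity> \<longleftrightarrow> integrable P (\<lambda>x. g x * q x)" if "g \<in> G" for g
    using nn_integral_total_var_finite_iff[OF q] G that by blast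
  moreover have "signed_integral P Q g = (\<integral>x. g x * q x \<partial>P)"
    if "g \<in> G" "integrable P (\<lambda>x. g x * q x)" for g
    using signed_integral_eq[OF q] G that by blast
  ultimately show ?thesis
    using assms(3,4) unfolding constraint_set_def ac_signed_measures_wrt_def by auto
qed

lemma phi_div_eq:
  assumes Q: "Q \<in> ac_signed_measures P" and q: "signed_density P Q q" and "prob_space P"
  shows "phi_div \<phi> Q P = (\<integral>\<^sup>+x. \<phi> (q x) \<partial>P)"
proof -
  have "AE x in P. density_of P Q x = q x"
    by (rule signed_density_unique[OF prob_space.signed_density_density_of[OF assms(3) Q] q])
  then show ?thesis using Q unfolding phi_div_def
    by (simp, intro nn_integral_cong_AE) (auto elim!: eventually_mono)
qed

text \<open>
  Countable additivity is inherited from the two finite measures with densities \<open>max 0 q\<close> and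
  \<open>max 0 (- q)\<close>.
\<close>

lemma ex_signed_measure_with_density:
  assumes q: "integrable M q"
  shows "\<exists>Q\<in>ac_signed_measures M. signed_density M Q q"
proof -
  define Q where "Q A = (if A \<in> sets M then LINT x:A|M. q x else 0)" for A
  note [measurable] = borel_measurable_integrable[OF q]
  have meas: "finite_measure (density M (\<lambda>x. ennreal (max 0 (u x))))"
      "measure (density M (\<lambda>x. ennreal (max 0 (u x)))) A = (\<integral>x. indicator A x * max 0 (u x) \<partial>M)"
    if u: "integrable M u" and A: "A \<in> sets M" for u A
  proof -
    have *: "integrable M (\<lambda>x. max 0 (u x))" using u by simp
    have int: "integrable M (\<lambda>x. indicator A x * max 0 (u x))" if "A \<in> sets M" for A
      using integrable_mult_indicator[OF that *] by simp
    have e: "emeasure (density M (\<lambda>x. ennreal (max 0 (u x)))) A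
        = ennreal (\<integral>x. indicator A x * max 0 (u x) \<partial>M)" if A: "A \<in> sets M" for A
    proof -
      have "emeasure (density M (\<lambda>x. ennreal (max 0 (u x)))) A
          = (\<integral>\<^sup>+x. ennreal (indicator A x * max 0 (u x)) \<partial>M)"
        using u A by (subst emeasure_density) (auto intro!: nn_integral_cong simp: indicator_def)
      also have "\<dots> = ennreal (\<integral>x. indicator A x * max 0 (u x) \<partial>M)"
        by (rule nn_integral_eq_integral[OF int[OF A]]) auto
      finally show ?thesis .
    qed
    show "finite_measure (density M (\<lambda>x. ennreal (max 0 (u x))))"
      by (rule finite_measureI) (unfold space_density e[OF sets.top], simp)
    show "measure (density M (\<lambda>x. ennreal (max 0 (u x)))) A = (\<integral>x. indicator A x * max 0 (u x) \<partial>M)"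
      unfolding measure_def e[OF A] by (rule enn2real_ennreal) (auto intro!: Bochner_Integration.integral_nonneg)
  qed
  define N where "N s = density M (\<lambda>x. ennreal (max 0 (s * q x)))" for s :: real
  have N: "finite_measure (N s)" "sets (N s) = sets M" for s
    using meas(1)[of "\<lambda>x. s * q x" "{}"] q by (simp_all add: N_def)
  have QN: "Q A = measure (N 1) A - measure (N (- 1)) A" if A: "A \<in> sets M" for A
  proof -
    have "integrable M (\<lambda>x. indicator A x * max 0 (1 * q x))"
        "integrable M (\<lambda>x. indicator A x * max 0 (- 1 * q x))"
      using integrable_mult_indicator[OF A, of "\<lambda>x. max 0 (q x)"]
        integrable_mult_indicator[OF A, of "\<lambda>x. max 0 (- q x)"] q by simp_all
    then have "measure (N 1) A - measure (N (- 1)) A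
        = (\<integral>x. indicator A x * max 0 (1 * q x) - indicator A x * max 0 (- 1 * q x) \<partial>M)"
      using meas(2)[of "\<lambda>x. 1 * q x" A] meas(2)[of "\<lambda>x. - 1 * q x" A] q A by (simp add: N_def)
    also have "\<dots> = (\<integral>x. indicator A x * q x \<partial>M)"
      by (rule Bochner_Integration.integral_cong) (auto simp: max_def)
    finally show ?thesis using A by (simp add: Q_def set_lebesgue_integral_def)
  qed
  have "(\<lambda>i. Q (A i)) sums Q (\<Union>i. A i)"
    if A: "range A \<subseteq> sets M" "disjoint_family A" for A :: "nat \<Rightarrow> _"
  proof -
    have "(\<lambda>i. measure (N s) (A i)) sums measure (N s) (\<Union>i. A i)" for s
      using finite_measure.finite_measure_UNION[OF N(1)] A N(2) by simp
    then have "(\<lambda>i. measure (N 1) (A i) - measure (N (- 1)) (A i))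
        sums (measure (N 1) (\<Union>i. A i) - measure (N (- 1)) (\<Union>i. A i))"
      by (intro sums_diff)
    moreover have "Q (A i) = measure (N 1) (A i) - measure (N (- 1)) (A i)" for i
      using A by (intro QN) auto
    moreover have "Q (\<Union>i. A i) = measure (N 1) (\<Union>i. A i) - measure (N (- 1)) (\<Union>i. A i)"
      using A by (intro QN) auto
    ultimately show ?thesis by simp
  qed
  moreover have "Q A = 0" if "A \<in> null_sets M" for A
  proof -
    have "(\<integral>x. indicator A x *\<^sub>R q x \<partial>M) = 0"
      by (rule integral_eq_zero_AE) (use AE_not_in[OF that] in \<open>auto elim!: eventually_mono\<close>)
    then show ?thesis by (simp add: Q_def set_lebesgue_integral_def)
  qed
  moreover have "Q {} = 0" "\<And>A. A \<notin> sets M \<Longrightarrow> Q A = 0" by (simp_all add: Q_def set_lebesgue_integral_def)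
  ultimately have "Q \<in> ac_signed_measures M"
    unfolding ac_signed_measures_def signed_measures_def by blast
  moreover have "signed_density M Q q" using q by (simp add: signed_density_def Q_def)
  ultimately show ?thesis by blast
qed

section \<open>Convex calculus of the divergence function\<close>

locale differentiable_divergence =
  fixes \<phi> :: "real \<Rightarrow> ennreal"
  assumes divergence: "divergence_fun \<phi>" and differentiable: "phi_differentiable \<phi>"
begin

text \<open>
  Real-valued, so that it can be differentiated and integrated; where \<open>\<phi>\<close> is infinite its value is 0
  and carries no meaning, so the lemmas below restrict to \<open>phi_dom \<phi>\<close>.
\<close>

definition F :: "real \<Rightarrow> real" where "F x = enn2real (\<phi> x)"

lemma phi_eq_F: "x \<in> phi_dom \<phi> \<Longrightarrow> \<phi> x = ennreal (F x)"
  by (simp add: phi_dom_def F_def)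

lemma F_nonneg: "0 \<le> F x" by (simp add: F_def)

lemma convex_combination:
  assumes "x \<in> phi_dom \<phi>" "y \<in> phi_dom \<phi>" "0 \<le> t" "t \<le> 1"
  shows "(1 - t) * x + t * y \<in> phi_dom \<phi>" "F ((1 - t) * x + t * y) \<le> (1 - t) * F x + t * F y"
proof -
  have "\<phi> ((1 - t) * x + t * y) \<le> ennreal (1 - t) * \<phi> x + ennreal t * \<phi> y"
    using divergence assms by (auto simp: divergence_fun_def ext_convex_def)
  also have "\<dots> = ennreal ((1 - t) * F x + t * F y)"
    using assms by (subst ennreal_plus) (auto simp: phi_eq_F ennreal_mult F_nonneg)
  finally have le: "\<phi> ((1 - t) * x + t * y) \<le> ennreal ((1 - t) * F x + t * F y)" .
  then show dom: "(1 - t) * x + t * y \<in> phi_dom \<phi>"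
    unfolding phi_dom_def by (simp add: le_less_trans)
  show "F ((1 - t) * x + t * y) \<le> (1 - t) * F x + t * F y"
  proof (subst ennreal_le_iff[symmetric])
    show "0 \<le> (1 - t) * F x + t * F y" using assms F_nonneg by simp
  qed (use le phi_eq_F[OF dom] in simp)
qed

lemma convex_dom: "convex (phi_dom \<phi>)"
  unfolding convex_alt using convex_combination(1) by simp

lemma convex_on_F: "convex_on (phi_dom \<phi>) F"
  by (rule convex_onI[OF _ convex_dom]) (simp add: convex_combination(2) less_imp_le)

text \<open>
  The sublevel sets of a convex function on the line are intervals.
\<close>

lemma phi_measurable [measurable]: "\<phi> \<in> borel_measurable borel"
proof (rule borel_measurableI_le)
  fix c :: ennreal
  let ?S = "{x. \<phi> x \<le> c}"
  have "z \<in> ?S" if xy: "x \<in> ?S" "y \<in> ?S" "x \<le> z" "z \<le> y" for x y z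
  proof (cases "x = y")
    case False
    then have "x < y" using xy by simp
    define t where "t = (z - x) / (y - x)"
    have t: "0 \<le> t" "t \<le> 1" using xy \<open>x < y\<close> by (auto simp: t_def field_simps)
    have z: "z = (1 - t) * x + t * y"
    proof -
      have "t * (y - x) = z - x" using \<open>x < y\<close> by (simp add: t_def)
      then show ?thesis by (simp add: algebra_simps)
    qed
    have "\<phi> z \<le> ennreal (1 - t) * \<phi> x + ennreal t * \<phi> y"
      using divergence t unfolding z by (auto simp: divergence_fun_def ext_convex_def)
    also have "\<dots> \<le> ennreal (1 - t) * c + ennreal t * c"
      using xy by (intro add_mono mult_left_mono) auto
    also have "\<dots> = (ennreal (1 - t) + ennreal t) * c" by (simp add: distrib_right)
    also have "\<dots> = c" using t by (simp flip: ennreal_plus)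
    finally show ?thesis by simp
  qed (use that in auto)
  then have "\<exists>a b. ?S = {} \<or> ?S = UNIV \<or> ?S = {..<b} \<or> ?S = {..b} \<or> ?S = {a<..} \<or> ?S = {a..} \<or>
      ?S = {a<..<b} \<or> ?S = {a<..b} \<or> ?S = {a..<b} \<or> ?S = {a..b}"
    by (rule interval_cases)
  then have "?S \<in> sets borel" by (elim exE disjE) simp_all
  then show "{x \<in> space borel. \<phi> x \<le> c} \<in> sets borel" by simp
qed

lemma F_measurable [measurable]: "F \<in> borel_measurable borel"
  unfolding F_def by measurable

lemma dom_bounds:
  assumes "x \<in> phi_dom \<phi>" shows "phi_lo \<phi> \<le> ereal x" "ereal x \<le> phi_hi \<phi>"
  using assms unfolding phi_lo_def phi_hi_def by (auto intro: INF_lower SUP_upper)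

lemma interior_domI:
  assumes "phi_lo \<phi> < ereal x" "ereal x < phi_hi \<phi>"
  shows "x \<in> interior (phi_dom \<phi>)"
proof -
  obtain y where y: "y \<in> phi_dom \<phi>" "y < x" using assms(1) by (auto simp: phi_lo_def INF_less_iff)
  obtain z where z: "z \<in> phi_dom \<phi>" "x < z" using assms(2) by (auto simp: phi_hi_def less_SUP_iff)
  have "{y<..<z} \<subseteq> phi_dom \<phi>"
  proof
    fix w assume "w \<in> {y<..<z}"
    then show "w \<in> phi_dom \<phi>"
      using connectedD_interval[OF convex_connected[OF convex_dom] y(1) z(1), of w] by simp
  qed
  then show ?thesis using y z by (intro interiorI[of "{y<..<z}"]) auto
qed

lemma in_domI: "phi_lo \<phi> < ereal x \<Longrightarrow> ereal x < phi_hi \<phi> \<Longrightarrow> x \<in> phi_dom \<phi>"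
  using interior_domI interior_subset by blast

lemma F_has_derivative:
  assumes "phi_lo \<phi> < ereal x" "ereal x < phi_hi \<phi>"
  shows "(F has_real_derivative deriv F x) (at x)"
proof -
  have "F differentiable at x"
    using differentiable assms unfolding phi_differentiable_def F_def[abs_def] by blast
  then show ?thesis
    by (simp add: DERIV_deriv_iff_real_differentiable)
qed

lemma F_above_tangent:
  assumes "phi_lo \<phi> < ereal x" "ereal x < phi_hi \<phi>" "y \<in> phi_dom \<phi>"
  shows "F x + deriv F x * (y - x) \<le> F y"
  using convex_on_imp_above_tangent[OF convex_on_F convex_connected[OF convex_dom] interior_domI[OF assms(1,2)] assms(3)
      has_field_derivative_at_within[OF F_has_derivative[OF assms(1,2)]]] by simp

lemma deriv_F_mono:
  assumes "phi_lo \<phi> < ereal x" "x < y" "ereal y < phi_hi \<phi>"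
  shows "deriv F x \<le> deriv F y"
proof -
  have "ereal x < ereal y" using assms(2) by simp
  then have x: "ereal x < phi_hi \<phi>" and y: "phi_lo \<phi> < ereal y"
    using assms(1,3) by (blast intro: less_trans)+
  have "F x + deriv F x * (y - x) \<le> F y" "F y + deriv F y * (x - y) \<le> F x"
    using assms x y by (blast intro: F_above_tangent in_domI)+
  then have "deriv F x * (y - x) \<le> deriv F y * (y - x)" by (simp add: algebra_simps)
  then show ?thesis using assms(2) by simp
qed

text \<open>
  Tangent inequalities pass to the limit along any filter of interior points; with the one-sided
  neighbourhood filters this yields the inequality at the endpoints of the domain.
\<close>

lemma tangent_at_limit:
  assumes "Fl \<noteq> bot" "eventually (\<lambda>x. phi_lo \<phi> < ereal x \<and> ereal x < phi_hi \<phi>) Fl"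
    and "((\<lambda>x. x) \<longlongrightarrow> e) Fl" "(F \<longlongrightarrow> F e) Fl" "(deriv F \<longlongrightarrow> h) Fl" "y \<in> phi_dom \<phi>"
  shows "F e + h * (y - e) \<le> F y"
proof (rule tendsto_upperbound)
  show "((\<lambda>x. F x + deriv F x * (y - x)) \<longlongrightarrow> F e + h * (y - e)) Fl"
    by (intro tendsto_intros assms)
  show "\<forall>\<^sub>F x in Fl. F x + deriv F x * (y - x) \<le> F y"
    using assms(2) by eventually_elim (use F_above_tangent assms(6) in blast)
qed (rule assms)

lemma F_tendsto:
  assumes "(\<phi> \<longlongrightarrow> \<phi> e) Fl" "e \<in> phi_dom \<phi>"
  shows "(F \<longlongrightarrow> F e) Fl"
proof -
  have "(\<phi> \<longlongrightarrow> ennreal (F e)) Fl" using assms(1) unfolding phi_eq_F[OF assms(2)] .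
  from tendsto_enn2real[OF this F_nonneg] show ?thesis by (simp only: F_def[abs_def])
qed

text \<open>
  The derivative is monotone, so its one-sided limit exists in the extended reals. The point 1
  only serves as some point to the right of \<open>a\<close> inside the domain.
\<close>

lemma deriv_F_limit_at_lo:
  assumes "phi_lo \<phi> = ereal a"
  shows "((\<lambda>x. ereal (deriv F x)) \<longlongrightarrow> (INF z\<in>{a<..<1}. ereal (deriv F z))) (at_right a)"
proof -
  have a: "a < 1" "ereal 1 < phi_hi \<phi>" using assms divergence by (auto simp: divergence_fun_def one_ereal_def)
  have I: "phi_lo \<phi> < ereal x \<and> ereal x < phi_hi \<phi>" if "a < x" "x < 1" for x
    using that a assms by (auto intro: less_trans[of _ "ereal 1"])
  show ?thesis
  proof (rule order_tendstoI)
    fix l assume l: "l < (INF z\<in>{a<..<1}. ereal (deriv F z))"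
    show "\<forall>\<^sub>F x in at_right a. l < ereal (deriv F x)"
      by (auto simp: eventually_at_right[OF a(1)] intro!: exI[of _ 1] a less_le_trans[OF l] INF_lower)
  next
    fix u assume "(INF z\<in>{a<..<1}. ereal (deriv F z)) < u"
    then obtain z where z: "a < z" "z < 1" "ereal (deriv F z) < u" by (auto simp: INF_less_iff)
    show "\<forall>\<^sub>F x in at_right a. ereal (deriv F x) < u"
      unfolding eventually_at_right[OF z(1)]
    proof (intro exI[of _ z] conjI z allI impI)
      fix x assume x: "a < x" "x < z"
      have "deriv F x \<le> deriv F z" using x z I by (intro deriv_F_mono) auto
      then show "ereal (deriv F x) < u" using z(3) by (meson ereal_less_eq(3) le_less_trans)
    qed
  qed
qed

lemma deriv_F_limit_at_hi:
  assumes "phi_hi \<phi> = ereal b"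
  shows "((\<lambda>x. ereal (deriv F x)) \<longlongrightarrow> (SUP z\<in>{1<..<b}. ereal (deriv F z))) (at_left b)"
proof -
  have b: "1 < b" "phi_lo \<phi> < ereal 1" using assms divergence by (auto simp: divergence_fun_def one_ereal_def)
  have I: "phi_lo \<phi> < ereal x \<and> ereal x < phi_hi \<phi>" if "1 < x" "x < b" for x
    using that b assms by (auto intro: less_trans[of _ "ereal 1"])
  show ?thesis
  proof (rule order_tendstoI)
    fix u assume u: "(SUP z\<in>{1<..<b}. ereal (deriv F z)) < u"
    show "\<forall>\<^sub>F x in at_left b. ereal (deriv F x) < u"
      by (auto simp: eventually_at_left[OF b(1)] intro!: exI[of _ 1] b le_less_trans[OF _ u] SUP_upper)
  next
    fix l assume "l < (SUP z\<in>{1<..<b}. ereal (deriv F z))"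
    then obtain z where z: "1 < z" "z < b" "l < ereal (deriv F z)" by (auto simp: less_SUP_iff)
    show "\<forall>\<^sub>F x in at_left b. l < ereal (deriv F x)"
      unfolding eventually_at_left[OF z(2)]
    proof (intro exI[of _ z] conjI z allI impI)
      fix x assume x: "z < x" "x < b"
      have "deriv F z \<le> deriv F x" using x z I by (intro deriv_F_mono) auto
      then show "l < ereal (deriv F x)" using z(3) by (meson ereal_less_eq(3) less_le_trans)
    qed
  qed
qed

lemma dphi_interior:
  assumes "phi_lo \<phi> < ereal x" "ereal x < phi_hi \<phi>"
  shows "dphi \<phi> x = ereal (deriv F x)"
proof -
  have "ereal x \<noteq> phi_lo \<phi>" "ereal x \<noteq> phi_hi \<phi>" using assms by auto
  then show ?thesis by (simp add: dphi_def Let_def F_def[abs_def])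
qed

lemma deriv_F_tendsto_dphi_lo:
  assumes "phi_lo \<phi> = ereal a"
  shows "((\<lambda>x. ereal (deriv F x)) \<longlongrightarrow> dphi \<phi> a) (at_right a)"
proof -
  have "dphi \<phi> a = Lim (at_right a) (\<lambda>x. ereal (deriv F x))"
    by (simp add: dphi_def Let_def assms F_def[abs_def])
  also have "\<dots> = (INF z\<in>{a<..<1}. ereal (deriv F z))"
    by (rule tendsto_Lim[OF _ deriv_F_limit_at_lo[OF assms]]) simp
  finally show ?thesis using deriv_F_limit_at_lo[OF assms] by simp
qed

lemma deriv_F_tendsto_dphi_hi:
  assumes "phi_hi \<phi> = ereal b"
  shows "((\<lambda>x. ereal (deriv F x)) \<longlongrightarrow> dphi \<phi> b) (at_left b)"
proof -
  have "phi_lo \<phi> < phi_hi \<phi>"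
    using divergence unfolding divergence_fun_def by (blast intro: less_trans)
  then have "ereal b \<noteq> phi_lo \<phi>" unfolding assms by (rule less_imp_neq[symmetric])
  then have "dphi \<phi> b = Lim (at_left b) (\<lambda>x. ereal (deriv F x))"
    by (simp add: dphi_def Let_def assms F_def[abs_def])
  also have "\<dots> = (SUP z\<in>{1<..<b}. ereal (deriv F z))"
    by (rule tendsto_Lim[OF _ deriv_F_limit_at_hi[OF assms]]) simp
  finally show ?thesis using deriv_F_limit_at_hi[OF assms] by simp
qed

text \<open>
  A real value of \<open>dphi\<close> at an endpoint means that the one-sided limit of the derivative is finite,
  and \<open>\<phi>\<close> is continuous up to the endpoint because it is closed.
\<close>

lemma dphi_subgradient:
  assumes x: "x \<in> phi_dom \<phi>" and y: "y \<in> phi_dom \<phi>" and h: "dphi \<phi> x = ereal h"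
  shows "F x + h * (y - x) \<le> F y"
proof -
  have ends: "phi_lo \<phi> < ereal 1" "ereal 1 < phi_hi \<phi>"
    using divergence by (auto simp: divergence_fun_def one_ereal_def)
  consider "ereal x = phi_lo \<phi>" | "ereal x \<noteq> phi_lo \<phi>" "ereal x = phi_hi \<phi>"
    | "phi_lo \<phi> < ereal x" "ereal x < phi_hi \<phi>"
    using dom_bounds[OF x] by (metis order_le_imp_less_or_eq)
  then show ?thesis
  proof cases
    case 1
    have nt: "at_right x \<noteq> bot" by simp
    have lim: "((\<lambda>x. ereal (deriv F x)) \<longlongrightarrow> ereal h) (at_right x)"
      using deriv_F_tendsto_dphi_lo[OF 1[symmetric]] by (simp only: h)
    have "x < 1" using ends(1) unfolding 1[symmetric] by simp
    show ?thesis
    proof (rule tangent_at_limit[OF nt _ _ _ _ y])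
      show "\<forall>\<^sub>F z in at_right x. phi_lo \<phi> < ereal z \<and> ereal z < phi_hi \<phi>"
        unfolding eventually_at_right[OF \<open>x < 1\<close>] 1[symmetric]
        using ends(2) \<open>x < 1\<close> by (auto intro!: exI[of _ 1] intro: less_trans[of _ "ereal 1"])
      show "(F \<longlongrightarrow> F x) (at_right x)"
        using divergence 1[symmetric] by (intro F_tendsto[OF _ x]) (simp add: divergence_fun_def ext_closed_def)
      show "(deriv F \<longlongrightarrow> h) (at_right x)" using lim by simp
    qed (rule tendsto_ident_at)
  next
    case 2
    have nt: "at_left x \<noteq> bot" by simp
    have lim: "((\<lambda>x. ereal (deriv F x)) \<longlongrightarrow> ereal h) (at_left x)"
      using deriv_F_tendsto_dphi_hi[OF 2(2)[symmetric]] by (simp only: h)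
    have "1 < x" using ends(2) unfolding 2(2)[symmetric] by simp
    show ?thesis
    proof (rule tangent_at_limit[OF nt _ _ _ _ y])
      show "\<forall>\<^sub>F z in at_left x. phi_lo \<phi> < ereal z \<and> ereal z < phi_hi \<phi>"
        unfolding eventually_at_left[OF \<open>1 < x\<close>] 2(2)[symmetric]
        using ends(1) \<open>1 < x\<close> by (auto intro!: exI[of _ 1] intro: less_trans[of _ "ereal 1"])
      show "(F \<longlongrightarrow> F x) (at_left x)"
        using divergence 2(2)[symmetric] by (intro F_tendsto[OF _ x]) (simp add: divergence_fun_def ext_closed_def)
      show "(deriv F \<longlongrightarrow> h) (at_left x)" using lim by simp
    qed (rule tendsto_ident_at)
  next
    case 3
    then have "h = deriv F x" using h dphi_interior by simp
    then show ?thesis using F_above_tangent[OF 3 y] by simp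
  qed
qed

section \<open>Sufficiency\<close>

lemma nn_integral_phi:
  assumes "integrable M (\<lambda>x. F (q x))" "AE x in M. q x \<in> phi_dom \<phi>"
  shows "(\<integral>\<^sup>+x. \<phi> (q x) \<partial>M) = ennreal (\<integral>x. F (q x) \<partial>M)"
proof -
  have "(\<integral>\<^sup>+x. \<phi> (q x) \<partial>M) = (\<integral>\<^sup>+x. ennreal (F (q x)) \<partial>M)"
    using assms(2) by (intro nn_integral_cong_AE) (auto elim!: eventually_mono simp: phi_eq_F)
  also have "\<dots> = ennreal (\<integral>x. F (q x) \<partial>M)"
    by (rule nn_integral_eq_integral[OF assms(1)]) (simp add: F_nonneg)
  finally show ?thesis .
qed

lemma integrable_F:
  assumes [measurable]: "q \<in> borel_measurable M" and fin: "(\<integral>\<^sup>+x. \<phi> (q x) \<partial>M) < \<infinity>"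
  shows "AE x in M. q x \<in> phi_dom \<phi>" "integrable M (\<lambda>x. F (q x))"
proof -
  have "AE x in M. \<phi> (q x) \<noteq> \<infinity>"
    by (rule nn_integral_PInf_AE) (use fin in auto)
  then show ae: "AE x in M. q x \<in> phi_dom \<phi>"
    by eventually_elim (simp add: phi_dom_def less_top)
  have "(\<integral>\<^sup>+x. ennreal (F (q x)) \<partial>M) = (\<integral>\<^sup>+x. \<phi> (q x) \<partial>M)"
    using ae by (intro nn_integral_cong_AE) (auto elim!: eventually_mono simp: phi_eq_F)
  then show "integrable M (\<lambda>x. F (q x))"
    using fin by (intro integrableI_nonneg) (auto simp: F_nonneg)
qed

text \<open>
  Integrate the subgradient inequality. The linear term has the form \<open>k (r - q)\<close> with \<open>k\<close> in the span
  of the constraints, and \<open>k q\<close> and \<open>k r\<close> have the same integral.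
\<close>

lemma projection_if_dphi_in_span:
  fixes P :: "'a measure" and g :: "nat \<Rightarrow> 'a \<Rightarrow> real"
  assumes P: "prob_space P" and G: "G \<subseteq> borel_measurable P" "indicat_real (space P) \<in> G"
    and Q: "Q \<in> constraint_set G P \<inter> div_dom \<phi> P"
    and g: "\<And>i. i \<in> {1..d} \<Longrightarrow> g i \<in> G"
    and h: "AE x in P. dphi \<phi> (density_of P Q x) = ereal (\<Sum>i=1..d. c i * g i x)"
  shows "is_projection \<phi> P (constraint_set G P) Q"
proof -
  have le: "phi_div \<phi> Q P \<le> phi_div \<phi> R P" if R: "R \<in> constraint_set G P" for R
  proof (cases "phi_div \<phi> R P < \<infinity>")
    case True
    have ac: "Q \<in> ac_signed_measures P" "R \<in> ac_signed_measures P"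
      using Q R by (auto simp: constraint_set_def ac_signed_measures_wrt_def)
    let ?q = "density_of P Q" and ?r = "density_of P R"
    note q = prob_space.signed_density_density_of[OF P ac(1)]
    note r = prob_space.signed_density_density_of[OF P ac(2)]
    have meas: "?q \<in> borel_measurable P" "?r \<in> borel_measurable P"
      using q r by (auto simp: signed_density_def)
    have fin: "(\<integral>\<^sup>+x. \<phi> (?q x) \<partial>P) < \<infinity>" "(\<integral>\<^sup>+x. \<phi> (?r x) \<partial>P) < \<infinity>"
      using Q True unfolding div_dom_def by (simp_all add: phi_div_eq[OF ac(1) q P] phi_div_eq[OF ac(2) r P])
    note Fq = integrable_F[OF meas(1) fin(1)] and Fr = integrable_F[OF meas(2) fin(2)]
    have Qg: "integrable P (\<lambda>x. g i x * ?q x)" "integrable P (\<lambda>x. g i x * ?r x)"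
        "(\<integral>x. g i x * ?q x \<partial>P) = (\<integral>x. g i x * ?r x \<partial>P)" if "i \<in> {1..d}" for i
      using Q R g[OF that] constraint_set_iff[OF q G ac(1)] constraint_set_iff[OF r G ac(2)] by auto
    define k where "k x = (\<Sum>i=1..d. c i * g i x)" for x
    have k: "k x * u = (\<Sum>i=1..d. c i * (g i x * u))" for x u
      by (simp add: k_def sum_distrib_right mult.assoc)
    have kq: "integrable P (\<lambda>x. k x * ?q x)" "integrable P (\<lambda>x. k x * ?r x)"
      unfolding k using Qg by auto
    have keq: "(\<integral>x. k x * ?q x \<partial>P) = (\<integral>x. k x * ?r x \<partial>P)"
      unfolding k using Qg by (subst (1 2) Bochner_Integration.integral_sum) auto
    have "(\<integral>x. F (?q x) \<partial>P) = (\<integral>x. F (?q x) + (k x * ?r x - k x * ?q x) \<partial>P)"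
      using Fq(2) kq keq by simp
    also have "\<dots> \<le> (\<integral>x. F (?r x) \<partial>P)"
    proof (rule integral_mono_AE)
      show "AE x in P. F (?q x) + (k x * ?r x - k x * ?q x) \<le> F (?r x)"
        using Fq(1) Fr(1) h
      proof eventually_elim
        fix x assume "?q x \<in> phi_dom \<phi>" "?r x \<in> phi_dom \<phi>"
          "dphi \<phi> (?q x) = ereal (\<Sum>i=1..d. c i * g i x)"
        from dphi_subgradient[OF this] show "F (?q x) + (k x * ?r x - k x * ?q x) \<le> F (?r x)"
          by (simp add: k_def right_diff_distrib)
      qed
    qed (use Fq(2) Fr(2) kq in auto)
    finally show ?thesis
      unfolding phi_div_eq[OF ac(1) q P] phi_div_eq[OF ac(2) r P]
      using nn_integral_phi[OF Fq(2,1)] nn_integral_phi[OF Fr(2,1)] by (simp add: ennreal_leI)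
  next
    case False
    then show ?thesis by (simp add: not_less top_unique)
  qed
  have "(INF R\<in>constraint_set G P. phi_div \<phi> R P) \<le> phi_div \<phi> Q P"
    using Q by (intro INF_lower) auto
  also have "\<dots> < \<infinity>" using Q by (simp add: div_dom_def)
  finally show ?thesis using Q le unfolding is_projection_def by auto
qed

end

section \<open>Linear spans of functions\<close>

lemma module_pointwise: "module (\<lambda>(c::real) (f :: 'a \<Rightarrow> real) x. c * f x)"
  by unfold_locales (auto simp: fun_eq_iff algebra_simps)

lemma fun_span_base: "g \<in> G \<Longrightarrow> g \<in> fun_span G"
  unfolding fun_span_def by (rule module.span_base[OF module_pointwise])

lemma fun_span_zero: "(\<lambda>x. 0) \<in> fun_span G"
  using module.span_zero[OF module_pointwise] by (simp add: fun_span_def zero_fun_def)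

lemma fun_span_lincomb: "u \<in> fun_span G \<Longrightarrow> v \<in> fun_span G \<Longrightarrow> (\<lambda>x. a * u x + v x) \<in> fun_span G"
  using module.span_add[OF module_pointwise module.span_scale[OF module_pointwise, of u G a], of v]
  by (simp add: fun_span_def plus_fun_def)

lemma integrable_fun_span:
  assumes "v \<in> fun_span G" "\<And>g. g \<in> G \<Longrightarrow> integrable M g"
  shows "integrable M v"
  using assms(1) unfolding fun_span_def
proof (induction rule: module.span_induct_alt[OF module_pointwise, consumes 1, case_names zero step])
  case zero
  then show ?case by (simp add: zero_fun_def)
next
  case (step c x y)
  then show ?case using assms(2) by (simp add: plus_fun_def)
qed

section \<open>Dilations inside the domain\<close>

context differentiable_divergence
begin

definition dilation_bound :: "real \<Rightarrow> bool" where
  "dilation_bound c \<longleftrightarrow> (\<exists>c1 c2 c3 :: real. \<forall>x::real.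
     enn2ereal (\<phi> (c * x)) \<le> ereal c1 * enn2ereal (\<phi> x) + ereal (c2 * \<bar>x\<bar>) + ereal c3)"

text \<open>
  The inequality is used only where \<open>\<phi> x\<close> is finite. There its right-hand side is finite too,
  so the dilated point stays in the domain.
\<close>

lemma dilation_boundD:
  assumes "dilation_bound c"
  obtains c1 c2 c3 where "\<And>x. x \<in> phi_dom \<phi> \<Longrightarrow> c * x \<in> phi_dom \<phi>"
    "\<And>x. x \<in> phi_dom \<phi> \<Longrightarrow> F (c * x) \<le> c1 * F x + c2 * \<bar>x\<bar> + c3"
proof -
  obtain c1 c2 c3 :: real where c:
    "\<And>x. enn2ereal (\<phi> (c * x)) \<le> ereal c1 * enn2ereal (\<phi> x) + ereal (c2 * \<bar>x\<bar>) + ereal c3"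
    using assms unfolding dilation_bound_def by blast
  have le: "enn2ereal (\<phi> (c * x)) \<le> ereal (c1 * F x + c2 * \<bar>x\<bar> + c3)" if "x \<in> phi_dom \<phi>" for x
    using c[of x] by (simp add: phi_eq_F[OF that] F_nonneg)
  have dom: "c * x \<in> phi_dom \<phi>" if "x \<in> phi_dom \<phi>" for x
  proof -
    have "enn2ereal (\<phi> (c * x)) < \<infinity>" using le[OF that] by (rule le_less_trans) simp
    then show ?thesis unfolding phi_dom_def by (cases "\<phi> (c * x)") (auto simp: less_top[symmetric])
  qed
  moreover have "F (c * x) \<le> c1 * F x + c2 * \<bar>x\<bar> + c3" if "x \<in> phi_dom \<phi>" for x
    using le[OF that] by (simp add: phi_eq_F[OF dom[OF that]] F_nonneg)
  ultimately show thesis by (rule that)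
qed

text \<open>
  The point lies strictly between its two dilates. In particular an endpoint of the domain other
  than 0 is excluded, where \<open>dphi\<close> would be a one-sided limit.
\<close>

lemma in_interior_if_dilatable:
  assumes "0 < \<delta>" "(1 - \<delta>) * x \<in> phi_dom \<phi>" "(1 + \<delta>) * x \<in> phi_dom \<phi>" "x \<noteq> 0"
  shows "phi_lo \<phi> < ereal x" "ereal x < phi_hi \<phi>"
proof -
  have "ereal (min ((1 - \<delta>) * x) ((1 + \<delta>) * x)) < ereal x"
       "ereal x < ereal (max ((1 - \<delta>) * x) ((1 + \<delta>) * x))"
    using assms(1,4) by (auto simp: min_less_iff_disj less_max_iff_disj algebra_simps zero_less_mult_iff mult_less_0_iff)
  moreover have "phi_lo \<phi> \<le> ereal (min ((1 - \<delta>) * x) ((1 + \<delta>) * x))"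
      "ereal (max ((1 - \<delta>) * x) ((1 + \<delta>) * x)) \<le> phi_hi \<phi>"
    using dom_bounds assms(2,3) by (auto simp: min_def max_def)
  ultimately show "phi_lo \<phi> < ereal x" "ereal x < phi_hi \<phi>"
    by (blast intro: less_le_trans le_less_trans)+
qed

text \<open>
  The point \<open>(1 + s) x\<close> is a convex combination of \<open>x\<close>, with weight \<open>1 - |s| / \<delta>\<close>, and the dilate of
  \<open>x\<close> on the same side.
\<close>

lemma F_dilation_le:
  assumes \<delta>: "0 < \<delta>" "(1 - \<delta>) * x \<in> phi_dom \<phi>" "(1 + \<delta>) * x \<in> phi_dom \<phi>" "x \<in> phi_dom \<phi>"
    and s: "\<bar>s\<bar> \<le> \<delta>"
  shows "(1 + s) * x \<in> phi_dom \<phi>"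
    "F ((1 + s) * x) - F x \<le> \<bar>s\<bar> / \<delta> * (\<bar>F ((1 - \<delta>) * x) - F x\<bar> + \<bar>F ((1 + \<delta>) * x) - F x\<bar>)"
proof -
  define t where "t = \<bar>s\<bar> / \<delta>"
  define y where "y = (if s \<ge> 0 then (1 + \<delta>) * x else (1 - \<delta>) * x)"
  have t: "0 \<le> t" "t \<le> 1" using \<delta> s by (auto simp: t_def)
  have y: "y \<in> phi_dom \<phi>" using assms by (simp add: y_def)
  have "t * \<delta> = \<bar>s\<bar>" using \<delta> by (simp add: t_def)
  then have eq: "(1 + s) * x = (1 - t) * x + t * y"
  proof -
    have "(1 - t) * x + t * y = x + (t * \<delta>) * (if s \<ge> 0 then x else - x)"
      by (simp add: y_def algebra_simps)
    then show ?thesis unfolding \<open>t * \<delta> = \<bar>s\<bar>\<close> by (simp add: algebra_simps)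
  qed
  show "(1 + s) * x \<in> phi_dom \<phi>" unfolding eq by (rule convex_combination(1)) (use t y assms in auto)
  have "F ((1 + s) * x) \<le> (1 - t) * F x + t * F y"
    unfolding eq by (rule convex_combination(2)) (use t y assms in auto)
  then have "F ((1 + s) * x) - F x \<le> t * (F y - F x)" by (simp add: algebra_simps)
  also have "\<dots> \<le> t * (\<bar>F ((1 - \<delta>) * x) - F x\<bar> + \<bar>F ((1 + \<delta>) * x) - F x\<bar>)"
    using t by (intro mult_left_mono) (auto simp: y_def)
  finally show "F ((1 + s) * x) - F x \<le> \<bar>s\<bar> / \<delta> * (\<bar>F ((1 - \<delta>) * x) - F x\<bar> + \<bar>F ((1 + \<delta>) * x) - F x\<bar>)"
    by (simp add: t_def)
qed

text \<open>
  The derivative made total by the value 0 outside the interior of the domain. This keeps it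
  measurable and allows statements without case distinction at \<open>x = 0\<close>, the only point that
  \<open>in_interior_if_dilatable\<close> leaves open and a null set for \<open>|Q|\<close> when \<open>x = dQ/dP\<close>.
\<close>

definition D :: "real \<Rightarrow> real" where
  "D x = (if phi_lo \<phi> < ereal x \<and> ereal x < phi_hi \<phi> then deriv F x else 0)"

lemma D_measurable [measurable]: "D \<in> borel_measurable borel"
proof (rule borel_measurable_LIMSEQ_real)
  let ?I = "\<lambda>x. phi_lo \<phi> < ereal x \<and> ereal x < phi_hi \<phi>"
  show "(\<lambda>n. if ?I x then (F (x + 1 / real (Suc n)) - F x) / (1 / real (Suc n)) else 0) \<longlonglongrightarrow> D x" for x
  proof (cases "?I x")
    case True
    then have "((\<lambda>h. (F (x + h) - F x) / h) \<longlongrightarrow> deriv F x) (at 0)"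
      using F_has_derivative by (simp add: DERIV_def)
    moreover have "filterlim (\<lambda>n. 1 / real (Suc n)) (at 0) sequentially"
    proof -
      have "(\<lambda>n. 1 / real (Suc n)) \<longlonglongrightarrow> 0" by (rule LIMSEQ_Suc[OF lim_1_over_n])
      then show ?thesis unfolding filterlim_at by simp
    qed
    ultimately have "(\<lambda>n. (F (x + 1 / real (Suc n)) - F x) / (1 / real (Suc n))) \<longlonglongrightarrow> deriv F x"
      by (rule filterlim_compose)
    then show ?thesis using True by (simp add: D_def)
  qed (auto simp: D_def)
qed measurable

text \<open>
  Compare the tangent at \<open>x\<close> with the values of \<open>F\<close> at the two dilates. Integrated, this shows that
  \<open>\<phi>'(q)\<close> is integrable with respect to \<open>|Q|\<close>.
\<close>

lemma D_dilation_bound: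
  assumes \<delta>: "0 < \<delta>" and x: "(1 - \<delta>) * x \<in> phi_dom \<phi>" "(1 + \<delta>) * x \<in> phi_dom \<phi>"
  shows "\<delta> * \<bar>D x * x\<bar> \<le> \<bar>F ((1 - \<delta>) * x) - F x\<bar> + \<bar>F ((1 + \<delta>) * x) - F x\<bar>"
proof (cases "x = 0")
  case False
  note I = in_interior_if_dilatable[OF \<delta> x False]
  have "F x + deriv F x * ((1 + \<delta>) * x - x) \<le> F ((1 + \<delta>) * x)"
    "F x + deriv F x * ((1 - \<delta>) * x - x) \<le> F ((1 - \<delta>) * x)"
    by (intro F_above_tangent I x)+
  then have "\<delta> * (D x * x) \<le> F ((1 + \<delta>) * x) - F x" "- (\<delta> * (D x * x)) \<le> F ((1 - \<delta>) * x) - F x"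
    using I by (simp_all add: D_def algebra_simps)
  then have "\<bar>\<delta> * (D x * x)\<bar> \<le> \<bar>F ((1 - \<delta>) * x) - F x\<bar> + \<bar>F ((1 + \<delta>) * x) - F x\<bar>" by linarith
  then show ?thesis using \<delta> by (simp add: abs_mult)
qed simp

text \<open>
  The factor \<open>a x\<close> is the derivative of \<open>(1 + t a) x\<close> in \<open>t\<close>. If it vanishes, both sides are 0.
\<close>

lemma difference_quotient_tendsto:
  assumes \<delta>: "0 < \<delta>" and x: "(1 - \<delta>) * x \<in> phi_dom \<phi>" "(1 + \<delta>) * x \<in> phi_dom \<phi>"
    and t: "t \<longlonglongrightarrow> 0" "\<And>n::nat. t n \<noteq> 0"
  shows "(\<lambda>n. (F ((1 + t n * a) * x) - F x) / t n) \<longlonglongrightarrow> D x * (a * x)"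
proof (cases "a * x = 0")
  case False
  note I = in_interior_if_dilatable[OF \<delta> x]
  have "((\<lambda>h. (F (x + h) - F x) / h) \<longlongrightarrow> D x) (at 0)"
    using F_has_derivative[OF I] I False by (simp add: DERIV_def D_def)
  moreover have "filterlim (\<lambda>n. t n * (a * x)) (at 0) sequentially"
    unfolding filterlim_at using tendsto_mult_left_zero[OF t(1), of "a * x"] t(2) False by simp
  ultimately have "(\<lambda>n. (F (x + t n * (a * x)) - F x) / (t n * (a * x))) \<longlonglongrightarrow> D x"
    by (rule filterlim_compose)
  then have "(\<lambda>n. (F (x + t n * (a * x)) - F x) / (t n * (a * x)) * (a * x)) \<longlonglongrightarrow> D x * (a * x)"
    by (intro tendsto_intros)
  moreover have "(F (x + t n * (a * x)) - F x) / (t n * (a * x)) * (a * x) = (F ((1 + t n * a) * x) - F x) / t n" for n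
  proof -
    have "x + t n * (a * x) = (1 + t n * a) * x" by (simp add: algebra_simps)
    moreover have "u / (t n * w) * w = u / t n" if "w \<noteq> 0" for u w :: real using that by simp
    ultimately show ?thesis using False by metis
  qed
  ultimately show ?thesis by simp
qed auto

text \<open>
  An integrable majorant, up to the factor \<open>1 / \<delta>\<close>, for all difference quotients of \<open>F\<close> along
  relative perturbations of size at most \<open>\<delta>\<close>.
\<close>

definition dilation_gap :: "real \<Rightarrow> real \<Rightarrow> real" where
  "dilation_gap \<delta> x = \<bar>F ((1 - \<delta>) * x) - F x\<bar> + \<bar>F ((1 + \<delta>) * x) - F x\<bar>"

text \<open>
  The upper bound is convexity between \<open>x\<close> and its dilates (\<open>F_dilation_le\<close>), the lower bound is the
  tangent at \<open>x\<close> together with \<open>D_dilation_bound\<close>.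
\<close>

lemma difference_quotient_bound:
  assumes \<delta>: "0 < \<delta>" and x: "(1 - \<delta>) * x \<in> phi_dom \<phi>" "(1 + \<delta>) * x \<in> phi_dom \<phi>" "x \<in> phi_dom \<phi>"
    and t: "0 < t" "t \<le> \<delta>" and a: "\<bar>a\<bar> \<le> 1"
  shows "\<bar>(F ((1 + t * a) * x) - F x) / t\<bar> \<le> dilation_gap \<delta> x / \<delta>"
proof -
  let ?B = "dilation_gap \<delta> x"
  have "\<bar>t * a\<bar> \<le> t * 1" unfolding abs_mult using t a by (intro mult_mono) auto
  then have s: "\<bar>t * a\<bar> \<le> t" "\<bar>t * a\<bar> \<le> \<delta>" using t by auto
  have dom: "(1 + t * a) * x \<in> phi_dom \<phi>"
    and up: "F ((1 + t * a) * x) - F x \<le> \<bar>t * a\<bar> / \<delta> * ?B"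
    using F_dilation_le[OF \<delta> x s(2)] by (auto simp: dilation_gap_def)
  have B: "0 \<le> ?B" by (simp add: dilation_gap_def)
  note up
  also have "\<bar>t * a\<bar> / \<delta> * ?B \<le> t / \<delta> * ?B"
    using s \<delta> B by (intro mult_right_mono divide_right_mono) auto
  finally have 1: "F ((1 + t * a) * x) - F x \<le> t * (?B / \<delta>)" by simp
  have 2: "- (t * (?B / \<delta>)) \<le> F ((1 + t * a) * x) - F x"
  proof (cases "x = 0")
    case False
    note I = in_interior_if_dilatable[OF \<delta> x(1,2) False]
    have "\<bar>D x * x\<bar> \<le> ?B / \<delta>"
      using D_dilation_bound[OF \<delta> x(1,2)] \<delta> unfolding dilation_gap_def
      by (subst pos_le_divide_eq) (simp_all only: mult.commute)
    then have "- (t * (?B / \<delta>)) \<le> - (t * \<bar>D x * x\<bar>)"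
      using t by (intro le_imp_neg_le mult_left_mono) auto
    also have "\<dots> \<le> - (\<bar>t * a\<bar> * \<bar>D x * x\<bar>)" using s by (simp add: mult_right_mono)
    also have "\<dots> \<le> t * a * (D x * x)" by (metis abs_ge_minus_self abs_mult minus_le_iff)
    also have "\<dots> = deriv F x * ((1 + t * a) * x - x)" using I by (simp add: D_def algebra_simps)
    also have "\<dots> \<le> F ((1 + t * a) * x) - F x" using F_above_tangent[OF I dom] by simp
    finally show ?thesis .
  qed (use B t \<delta> in simp)
  have "\<bar>F ((1 + t * a) * x) - F x\<bar> \<le> t * (?B / \<delta>)" using 1 2 by linarith
  then show ?thesis using t by (simp add: pos_divide_le_eq mult.commute)
qed

section \<open>First variation at a projection\<close>

lemma integrable_F_dilation:
  assumes q: "integrable M q" "finite_measure M" and F: "integrable M (\<lambda>x. F (q x))" "AE x in M. q x \<in> phi_dom \<phi>"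
    and c: "dilation_bound c"
  shows "AE x in M. c * q x \<in> phi_dom \<phi>" "integrable M (\<lambda>x. F (c * q x))"
proof -
  note [measurable] = borel_measurable_integrable[OF q(1)]
  obtain c1 c2 c3 where b: "\<And>x. x \<in> phi_dom \<phi> \<Longrightarrow> c * x \<in> phi_dom \<phi>"
    "\<And>x. x \<in> phi_dom \<phi> \<Longrightarrow> F (c * x) \<le> c1 * F x + c2 * \<bar>x\<bar> + c3"
    using dilation_boundD[OF c] by blast
  show "AE x in M. c * q x \<in> phi_dom \<phi>" using F(2) by eventually_elim (rule b)
  show "integrable M (\<lambda>x. F (c * q x))"
  proof (rule Bochner_Integration.integrable_bound)
    show "integrable M (\<lambda>x. c1 * F (q x) + c2 * \<bar>q x\<bar> + c3)"
      by (intro Bochner_Integration.integrable_add integrable_mult_right integrable_abs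
          finite_measure.integrable_const q F(1))
    show "AE x in M. norm (F (c * q x)) \<le> norm (c1 * F (q x) + c2 * \<bar>q x\<bar> + c3)"
      using F(2)
    proof eventually_elim
      fix x assume "q x \<in> phi_dom \<phi>"
      from b(2)[OF this] show "norm (F (c * q x)) \<le> norm (c1 * F (q x) + c2 * \<bar>q x\<bar> + c3)"
        using F_nonneg[of "c * q x"] by simp
    qed
  qed measurable
qed

lemma projection_dilations:
  assumes P: "prob_space P" and proj: "is_projection \<phi> P (constraint_set G P) Q"
    and q: "signed_density P Q q"
    and \<delta>: "dilation_bound (1 - \<delta>)" "dilation_bound (1 + \<delta>)"
  shows "AE x in P. q x \<in> phi_dom \<phi>" "AE x in P. (1 - \<delta>) * q x \<in> phi_dom \<phi>"
    "AE x in P. (1 + \<delta>) * q x \<in> phi_dom \<phi>" "integrable P (\<lambda>x. F (q x))"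
    "integrable P (\<lambda>x. dilation_gap \<delta> (q x) / \<delta>)"
proof -
  have int_q: "integrable P q" using q by (simp add: signed_density_def)
  have QS: "Q \<in> constraint_set G P"
    and min: "\<And>R. R \<in> constraint_set G P \<Longrightarrow> phi_div \<phi> Q P \<le> phi_div \<phi> R P"
    and inf: "(INF R\<in>constraint_set G P. phi_div \<phi> R P) < \<infinity>"
    using proj by (auto simp: is_projection_def)
  have ac: "Q \<in> ac_signed_measures P"
    using QS by (simp add: constraint_set_def ac_signed_measures_wrt_def)
  obtain R where "R \<in> constraint_set G P" "phi_div \<phi> R P < \<infinity>"
    using inf unfolding INF_less_iff by blast
  then have "phi_div \<phi> Q P < \<infinity>" by (blast intro: le_less_trans[OF min])
  then have "(\<integral>\<^sup>+x. \<phi> (q x) \<partial>P) < \<infinity>" by (simp add: phi_div_eq[OF ac q P])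
  note Fq = integrable_F[OF borel_measurable_integrable[OF int_q] this]
  note lo = integrable_F_dilation[OF int_q prob_space.finite_measure[OF P] Fq(2,1) \<delta>(1)]
  note hi = integrable_F_dilation[OF int_q prob_space.finite_measure[OF P] Fq(2,1) \<delta>(2)]
  show "AE x in P. q x \<in> phi_dom \<phi>" "AE x in P. (1 - \<delta>) * q x \<in> phi_dom \<phi>"
    "AE x in P. (1 + \<delta>) * q x \<in> phi_dom \<phi>" "integrable P (\<lambda>x. F (q x))"
    by (rule Fq lo hi)+
  show "integrable P (\<lambda>x. dilation_gap \<delta> (q x) / \<delta>)"
    using Fq(2) lo(2) hi(2) by (simp add: dilation_gap_def)
qed

text \<open>
  Since \<open>h\<close> annihilates \<open>G\<close> with respect to \<open>|Q|\<close>, the density \<open>(1 + t h sgn q) q = q + t h |q|\<close> is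
  admissible for every \<open>t\<close>, and its divergence is finite for \<open>t \<le> \<delta>\<close>. Minimality of \<open>Q\<close> makes all
  difference quotients for \<open>t > 0\<close> nonnegative in the mean; dominated convergence does the rest.
\<close>

lemma first_variation_nonneg:
  fixes P :: "'a measure" and G :: "('a \<Rightarrow> real) set"
  defines "S \<equiv> constraint_set G P"
  assumes P: "prob_space P" and G: "G \<subseteq> borel_measurable P" "indicat_real (space P) \<in> G"
    and proj: "is_projection \<phi> P S Q" and q: "signed_density P Q q"
    and \<delta>: "0 < \<delta>" "dilation_bound (1 - \<delta>)" "dilation_bound (1 + \<delta>)"
    and h [measurable]: "h \<in> borel_measurable P" and h_le: "\<And>x. \<bar>h x\<bar> \<le> 1"
    and ann: "\<And>g. g \<in> G \<Longrightarrow> (\<integral>x. \<bar>q x\<bar> * (h x * g x) \<partial>P) = 0"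
  shows "0 \<le> (\<integral>x. \<bar>q x\<bar> * (h x * D (q x)) \<partial>P)"
proof -
  interpret P: prob_space P by (rule P)
  have int_q: "integrable P q" using q by (simp add: signed_density_def)
  note [measurable] = borel_measurable_integrable[OF int_q]
  have QS: "Q \<in> S" and min: "\<And>R. R \<in> S \<Longrightarrow> phi_div \<phi> Q P \<le> phi_div \<phi> R P"
    using proj by (auto simp: is_projection_def)
  have ac: "Q \<in> ac_signed_measures P"
    using QS by (simp add: S_def constraint_set_def ac_signed_measures_wrt_def)
  note dom = projection_dilations(1-3)[OF P proj[unfolded S_def] q \<delta>(2,3)]
    and int_F = projection_dilations(4)[OF P proj[unfolded S_def] q \<delta>(2,3)]
    and int_gap = projection_dilations(5)[OF P proj[unfolded S_def] q \<delta>(2,3)]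
  \<comment> \<open>The relative perturbation of \<open>q\<close>, chosen such that \<open>a q = h |q|\<close>.\<close>
  define a where "a x = h x * sgn (q x)" for x
  have a_meas [measurable]: "a \<in> borel_measurable P" unfolding a_def by measurable
  have a_le: "\<bar>a x\<bar> \<le> 1" for x using h_le[of x] by (simp add: a_def abs_mult sgn_if)
  have aq: "a x * q x = \<bar>q x\<bar> * h x" for x by (simp add: a_def sgn_if)
  \<comment> \<open>Steps of size at most \<open>\<delta>\<close> keep the perturbed density between the two dilates of \<open>q\<close>.\<close>
  define t where "t n = \<delta> / real (Suc n)" for n
  have t: "0 < t n" "t n \<le> \<delta>" for n using \<delta>(1) by (auto simp: t_def field_simps)
  have t0: "t \<longlonglongrightarrow> 0" unfolding t_def by (rule LIMSEQ_Suc[OF lim_const_over_n])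
  define r where "r n x = (1 + t n * a x) * q x" for n x
  define u where "u n x = (F (r n x) - F (q x)) / t n" for n x
  have [measurable]: "r n \<in> borel_measurable P" "u n \<in> borel_measurable P" for n
    unfolding u_def r_def by measurable
  have u_le: "AE x in P. norm (u n x) \<le> dilation_gap \<delta> (q x) / \<delta>" for n
    using dom
  proof eventually_elim
    fix x assume *: "q x \<in> phi_dom \<phi>" "(1 - \<delta>) * q x \<in> phi_dom \<phi>" "(1 + \<delta>) * q x \<in> phi_dom \<phi>"
    show "norm (u n x) \<le> dilation_gap \<delta> (q x) / \<delta>"
      unfolding u_def r_def real_norm_def by (rule difference_quotient_bound[OF \<delta>(1) *(2,3,1) t a_le])
  qed
  have int_u: "integrable P (u n)" for n
  proof (rule Bochner_Integration.integrable_bound[OF int_gap])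
    show "AE x in P. norm (u n x) \<le> norm (dilation_gap \<delta> (q x) / \<delta>)"
      using u_le[of n] by eventually_elim (metis abs_ge_self order_trans real_norm_def)
  qed measurable
  have u_nonneg: "0 \<le> (\<integral>x. u n x \<partial>P)" for n
  proof -
    have r_dom: "AE x in P. r n x \<in> phi_dom \<phi>"
      using dom
    proof eventually_elim
      fix x assume *: "q x \<in> phi_dom \<phi>" "(1 - \<delta>) * q x \<in> phi_dom \<phi>" "(1 + \<delta>) * q x \<in> phi_dom \<phi>"
      have "\<bar>t n * a x\<bar> \<le> t n * 1" using t[of n] a_le[of x] unfolding abs_mult by (intro mult_mono) auto
      then have "\<bar>t n * a x\<bar> \<le> \<delta>" using t(2)[of n] by simp
      from F_dilation_le(1)[OF \<delta>(1) *(2,3,1) this] show "r n x \<in> phi_dom \<phi>" by (simp add: r_def)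
    qed
    have Fr: "F (r n x) = F (q x) + t n * u n x" for x using t(1)[of n] by (simp add: u_def)
    have int_Fr: "integrable P (\<lambda>x. F (r n x))" unfolding Fr using int_F int_u by simp
    have "integrable P (\<lambda>x. a x * q x)" by (rule integrable_bounded_mult[OF int_q a_meas a_le])
    then have "integrable P (r n)" using int_q by (simp add: r_def[abs_def] distrib_right mult.assoc)
    then obtain R where R: "R \<in> ac_signed_measures P" "signed_density P R (r n)"
      using ex_signed_measure_with_density by blast
    have "R \<in> S"
      unfolding S_def constraint_set_iff[OF R(2) G R(1)]
    proof
      fix g assume g: "g \<in> G"
      then have gq: "integrable P (\<lambda>x. g x * q x)"
          "(\<integral>x. g x * q x \<partial>P) = (if g = indicat_real (space P) then 1 else 0)"
        using QS unfolding S_def constraint_set_iff[OF q G ac] by auto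
      have gaq: "integrable P (\<lambda>x. a x * (g x * q x))"
        by (rule integrable_bounded_mult[OF gq(1) a_meas a_le])
      have "a x * (g x * q x) = \<bar>q x\<bar> * (h x * g x)" for x using aq[of x] by (simp add: mult_ac)
      then have zero: "(\<integral>x. a x * (g x * q x) \<partial>P) = 0" by (simp only: ann[OF g])
      have gr: "(\<lambda>x. g x * r n x) = (\<lambda>x. g x * q x + t n * (a x * (g x * q x)))"
        by (simp add: r_def algebra_simps)
      have "(\<integral>x. g x * q x + t n * (a x * (g x * q x)) \<partial>P) = (\<integral>x. g x * q x \<partial>P)"
        using gq(1) gaq zero by simp
      then show "integrable P (\<lambda>x. g x * r n x) \<and>
          (\<integral>x. g x * r n x \<partial>P) = (if g = indicat_real (space P) then 1 else 0)"
        unfolding gr gq(2)[symmetric] using gq(1) gaq by simp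
    qed
    from min[OF this] have "ennreal (\<integral>x. F (q x) \<partial>P) \<le> ennreal (\<integral>x. F (r n x) \<partial>P)"
      unfolding phi_div_eq[OF ac q P] phi_div_eq[OF R P]
        nn_integral_phi[OF int_F dom(1)] nn_integral_phi[OF int_Fr r_dom] .
    then have "(\<integral>x. F (q x) \<partial>P) \<le> (\<integral>x. F (r n x) \<partial>P)"
      by (simp add: ennreal_le_iff[OF Bochner_Integration.integral_nonneg] F_nonneg)
    also have "\<dots> = (\<integral>x. F (q x) \<partial>P) + t n * (\<integral>x. u n x \<partial>P)"
      unfolding Fr using int_F int_u by simp
    finally show ?thesis using t(1)[of n] by (simp add: zero_le_mult_iff)
  qed
  have "(\<lambda>n. \<integral>x. u n x \<partial>P) \<longlonglongrightarrow> (\<integral>x. D (q x) * (a x * q x) \<partial>P)"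
  proof (rule integral_dominated_convergence[OF _ _ int_gap _ u_le])
    show "AE x in P. (\<lambda>n. u n x) \<longlonglongrightarrow> D (q x) * (a x * q x)"
      using dom(2,3)
    proof eventually_elim
      fix x assume "(1 - \<delta>) * q x \<in> phi_dom \<phi>" "(1 + \<delta>) * q x \<in> phi_dom \<phi>"
      then show "(\<lambda>n. u n x) \<longlonglongrightarrow> D (q x) * (a x * q x)"
        unfolding u_def r_def
        by (rule difference_quotient_tendsto[OF \<delta>(1) _ _ t0 less_imp_neq[OF t(1), symmetric]])
    qed
  qed measurable
  then have "0 \<le> (\<integral>x. D (q x) * (a x * q x) \<partial>P)"
    by (rule LIMSEQ_le_const) (use u_nonneg in auto)
  then show ?thesis by (simp add: aq mult_ac)
qed

text \<open>
  The first variation in the directions \<open>h\<close> and \<open>-h\<close> shows that every bounded annihilator of the span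
  of \<open>G\<close> in \<open>L1(|Q|)\<close> also kills \<open>\<phi>'(q)\<close>.
\<close>

lemma dphi_in_L1_closure:
  fixes P :: "'a measure" and G :: "('a \<Rightarrow> real) set"
  assumes P: "prob_space P" and G: "G \<subseteq> borel_measurable P" "indicat_real (space P) \<in> G"
    and proj: "is_projection \<phi> P (constraint_set G P) Q"
    and \<delta>: "0 < \<delta>" "dilation_bound (1 - \<delta>)" "dilation_bound (1 + \<delta>)"
  shows "\<exists>f \<in> L1_closure (total_var P Q) (fun_span G).
     AE x in total_var P Q. dphi \<phi> (density_of P Q x) = ereal (f x)"
proof -
  interpret P: prob_space P by (rule P)
  define q where "q = density_of P Q"
  have QS: "Q \<in> constraint_set G P" using proj by (simp add: is_projection_def)
  have ac: "Q \<in> ac_signed_measures P"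
    using QS by (simp add: constraint_set_def ac_signed_measures_wrt_def)
  have q: "signed_density P Q q" unfolding q_def by (rule P.signed_density_density_of[OF ac])
  then have int_q: "integrable P q" by (simp add: signed_density_def)
  note [measurable] = borel_measurable_integrable[OF int_q]
  note dom = projection_dilations(2,3)[OF P proj q \<delta>(2,3)]
    and int_gap = projection_dilations(5)[OF P proj q \<delta>(2,3)]
  define \<mu> where "\<mu> = total_var P Q"
  have \<mu>: "\<mu> = density P (\<lambda>x. ennreal \<bar>q x\<bar>)" unfolding \<mu>_def by (rule total_var_eq_density[OF q])
  have sets_\<mu>: "sets \<mu> = sets P" by (simp add: \<mu>)
  interpret \<mu>: finite_measure \<mu>
  proof
    have "emeasure \<mu> (space \<mu>) = (\<integral>\<^sup>+x. ennreal \<bar>q x\<bar> \<partial>P)"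
      unfolding \<mu> by (subst emeasure_density) (auto intro!: nn_integral_cong)
    then show "emeasure \<mu> (space \<mu>) \<noteq> \<infinity>" using int_q by (simp add: integrable_iff_bounded)
  qed
  have "AE x in P. norm (D (q x) * q x) \<le> norm (dilation_gap \<delta> (q x) / \<delta>)"
    using dom
  proof eventually_elim
    fix x assume "(1 - \<delta>) * q x \<in> phi_dom \<phi>" "(1 + \<delta>) * q x \<in> phi_dom \<phi>"
    from D_dilation_bound[OF \<delta>(1) this] \<delta>(1)
    have "\<bar>D (q x) * q x\<bar> \<le> dilation_gap \<delta> (q x) / \<delta>"
      by (simp add: dilation_gap_def field_simps)
    then show "norm (D (q x) * q x) \<le> norm (dilation_gap \<delta> (q x) / \<delta>)"
      unfolding real_norm_def by (rule order_trans[OF _ abs_ge_self])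
  qed
  then have "integrable P (\<lambda>x. D (q x) * q x)"
    by (intro Bochner_Integration.integrable_bound[OF int_gap]) auto
  then have int_D: "integrable \<mu> (\<lambda>x. D (q x))"
    unfolding \<mu>_def by (subst integrable_total_var_iff[OF q]) auto
  have int_G: "integrable \<mu> g" if "g \<in> G" for g
    unfolding \<mu>_def using that G QS integrable_total_var_iff[OF q, of g] constraint_set_iff[OF q G ac] by blast
  have int_V: "integrable \<mu> v" if "v \<in> fun_span G" for v
    by (rule integrable_fun_span[OF that int_G])
  have ann_D: "(\<integral>x. h x * D (q x) \<partial>\<mu>) = 0"
    if h: "h \<in> borel_measurable \<mu>" "\<And>x. \<bar>h x\<bar> \<le> 1" "\<And>v. v \<in> fun_span G \<Longrightarrow> (\<integral>x. h x * v x \<partial>\<mu>) = 0"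
    for h
  proof -
    have [measurable]: "h \<in> borel_measurable P" using h(1) by (simp add: \<mu>)
    have ann: "(\<integral>x. \<bar>q x\<bar> * (h x * g x) \<partial>P) = 0" if g: "g \<in> G" for g
    proof -
      have [measurable]: "g \<in> borel_measurable P" using g G by auto
      show ?thesis
        using h(3)[OF fun_span_base[OF g]] unfolding \<mu>_def by (subst (asm) integral_total_var[OF q]) auto
    qed
    note var = first_variation_nonneg[OF P G proj q \<delta>]
    have "0 \<le> (\<integral>x. \<bar>q x\<bar> * (h x * D (q x)) \<partial>P)"
      by (rule var) (use h(2) ann in auto)
    moreover have "0 \<le> (\<integral>x. \<bar>q x\<bar> * (- h x * D (q x)) \<partial>P)"
      by (rule var) (use h(2) ann in auto)
    ultimately have "(\<integral>x. \<bar>q x\<bar> * (h x * D (q x)) \<partial>P) = 0" by simp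
    then show ?thesis unfolding \<mu>_def by (subst integral_total_var[OF q]) auto
  qed
  have approx: "\<exists>v\<in>fun_span G. (\<integral>x. \<bar>D (q x) - v x\<bar> \<partial>\<mu>) < \<epsilon>" if "0 < \<epsilon>" for \<epsilon>
    by (rule \<mu>.L1_approx_if_annihilated[OF _ _ int_V int_D _ that])
      (fact fun_span_zero fun_span_lincomb ann_D | assumption)+
  have "(\<lambda>x. D (q x)) \<in> L1_closure \<mu> (fun_span G)"
    unfolding L1_closure_def
  proof (intro CollectI conjI allI impI int_D)
    fix \<epsilon> :: real assume "0 < \<epsilon>"
    then obtain v where "v \<in> fun_span G" "(\<integral>x. \<bar>D (q x) - v x\<bar> \<partial>\<mu>) < \<epsilon>"
      using approx by blast
    then show "\<exists>v\<in>fun_span G. integrable \<mu> v \<and> (\<integral>x. \<bar>D (q x) - v x\<bar> \<partial>\<mu>) < \<epsilon>"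
      using int_V by blast
  qed
  moreover have "AE x in \<mu>. dphi \<phi> (q x) = ereal (D (q x))"
  proof -
    have "AE x in P. 0 < ennreal \<bar>q x\<bar> \<longrightarrow> dphi \<phi> (q x) = ereal (D (q x))"
      using dom
    proof eventually_elim
      fix x assume *: "(1 - \<delta>) * q x \<in> phi_dom \<phi>" "(1 + \<delta>) * q x \<in> phi_dom \<phi>"
      show "0 < ennreal \<bar>q x\<bar> \<longrightarrow> dphi \<phi> (q x) = ereal (D (q x))"
      proof
        assume "0 < ennreal \<bar>q x\<bar>"
        then have "q x \<noteq> 0" by auto
        note I = in_interior_if_dilatable[OF \<delta>(1) * this]
        show "dphi \<phi> (q x) = ereal (D (q x))" using dphi_interior[OF I] I by (simp add: D_def)
      qed
    qed
    then show ?thesis unfolding \<mu> by (subst AE_density) auto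
  qed
  ultimately show ?thesis unfolding \<mu>_def q_def by (intro bexI[where x = "\<lambda>x. D (density_of P Q x)"])
qed

end

theorem theorem3p6:
  fixes P :: "'a measure"
    and \<phi> :: "real \<Rightarrow> ennreal"
    and G :: "('a \<Rightarrow> real) set"
  assumes "prob_space P"
    and "divergence_fun \<phi>"
    and "phi_differentiable \<phi>"
    and "G \<subseteq> borel_measurable P"
    and "indicat_real (space P) \<in> G"
  shows
    "(\<forall>Q \<in> constraint_set G P \<inter> div_dom \<phi> P.
        (\<exists>(d::nat) (c :: nat \<Rightarrow> real) (g :: nat \<Rightarrow> 'a \<Rightarrow> real).
           (\<forall>i\<in>{1..d}. g i \<in> G) \<and>
           (AE x in P. dphi \<phi> (density_of P Q x) = ereal (\<Sum>i=1..d. c i * g i x)))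
        \<longrightarrow> is_projection \<phi> P (constraint_set G P) Q)
     \<and>
     ((\<exists>\<delta>::real. 0 < \<delta> \<and> \<delta> < 1 \<and>
         (\<forall>c\<in>{1 - \<delta>..1 + \<delta>}. \<exists>c1 c2 c3 :: real. \<forall>x::real.
            enn2ereal (\<phi> (c * x)) \<le> ereal c1 * enn2ereal (\<phi> x) + ereal (c2 * \<bar>x\<bar>) + ereal c3))
      \<longrightarrow>
      (\<forall>Q. is_projection \<phi> P (constraint_set G P) Q \<longrightarrow>
         (\<exists>f \<in> L1_closure (total_var P Q) (fun_span G).
            AE x in total_var P Q. dphi \<phi> (density_of P Q x) = ereal (f x))))"
proof (intro conjI ballI allI impI)
  interpret differentiable_divergence \<phi> by unfold_locales (rule assms)+
  {
    fix Q assume Q: "Q \<in> constraint_set G P \<inter> div_dom \<phi> P"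
    assume "\<exists>(d::nat) (c :: nat \<Rightarrow> real) (g :: nat \<Rightarrow> 'a \<Rightarrow> real).
           (\<forall>i\<in>{1..d}. g i \<in> G) \<and>
           (AE x in P. dphi \<phi> (density_of P Q x) = ereal (\<Sum>i=1..d. c i * g i x))"
    then show "is_projection \<phi> P (constraint_set G P) Q"
      using projection_if_dphi_in_span[OF assms(1,4,5) Q] by blast
  next
    fix Q assume proj: "is_projection \<phi> P (constraint_set G P) Q"
    assume "\<exists>\<delta>::real. 0 < \<delta> \<and> \<delta> < 1 \<and>
         (\<forall>c\<in>{1 - \<delta>..1 + \<delta>}. \<exists>c1 c2 c3 :: real. \<forall>x::real.
            enn2ereal (\<phi> (c * x)) \<le> ereal c1 * enn2ereal (\<phi> x) + ereal (c2 * \<bar>x\<bar>) + ereal c3)"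
    then obtain \<delta> :: real where \<delta>: "0 < \<delta>" "\<And>c. c \<in> {1 - \<delta>..1 + \<delta>} \<Longrightarrow> dilation_bound c"
      unfolding dilation_bound_def by blast
    show "\<exists>f \<in> L1_closure (total_var P Q) (fun_span G).
            AE x in total_var P Q. dphi \<phi> (density_of P Q x) = ereal (f x)"
      by (rule dphi_in_L1_closure[OF assms(1,4,5) proj \<delta>(1) \<delta>(2) \<delta>(2)]) (use \<delta>(1) in auto)
  }
qed

end
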